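(* Let $\Omega\subseteq\mathbb{R}^2$ be an open domain and let $u:\Omega\to\mathbb{R}$ be any bounded solution of the translating soliton equation $$\operatorname{div}\left(\frac{\nabla u}{\sqrt{1+|\nabla u|^2}}\right)=-\frac{\partial_3u}{\sqrt{1+|\nabla u|^2}} .$$ Then $$|\operatorname{Hess}u|(p)\le\frac{K}{\operatorname{dist}(p,\partial\Omega)},\qquad p\in\Omega',$$ for any $\Omega'\subsetneq\Omega$ with $\operatorname{dist}(\partial\Omega',\partial\Omega)\ge1$, where $K=K(\|u\|_\infty)>0$ is a universal constant depending only on the supremum norm of $u$. If $\Omega$ satisfies the upward sausages property, this can be strengthened to $$|\operatorname{Hess}u|(p)\le\frac{K}{(\operatorname{dist}(p,\partial\Omega))^2},\qquad p\in\Omega' ,$$ with $K=K(\|u\|_\infty)$.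
   Context: Coordinates on $\mathbb{R}^2$ are $(x_2,x_3)$, $\nabla u=(\partial_2u,\partial_3u)$, $(\operatorname{Hess}u)_{ij}=\partial^2_{ij}u$, $\mathbf{e}_3=(0,1)$. The equation says that $\{(u(x_2,x_3),x_2,x_3)\}\subset\mathbb{R}^3$ is a translating soliton of mean curvature flow with velocity in the $x_3$-direction. Solutions are classical (smooth). The upward sausage of width $\rho>0$ at $p$ is $S^+_\rho(p)=\bigcup_{t\in[0,\rho^2)}(B_\rho(p)+t\,\mathbf{e}_3)$. $\Omega$ has the upward sausages property if $\partial\Omega=\emptyset$ or, when $\partial\Omega\ne\emptyset$, $S^+_\rho(p)\subseteq\Omega$ with $\rho=\operatorname{dist}(p,\partial\Omega)$ for every $p\in\Omega$. If $\partial\Omega=\emptyset$, the distance is $+\infty$ and the right-hand sides are read as $0$. *)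

theory Defs
  imports "HOL-Analysis.Analysis"
begin

text \<open>
  Points of the plane are vectors of type \<open>real ^ 2\<close>. The coordinates called $x_2, x_3$ in the
  mathematical text are the components \<open>x $ 1\<close> and \<open>x $ 2\<close>, in this order; $x_1$ is the
  direction of the values of the graph function.

  Functions are total, but all differential expressions below are evaluated only at points of an
  open set on which the function is smooth, so they do not depend on values outside that set.
\<close>

definition partial :: "2 \<Rightarrow> (real ^ 2 \<Rightarrow> real) \<Rightarrow> real ^ 2 \<Rightarrow> real" where
  "partial i f x = frechet_derivative f (at x) (axis i 1)"

abbreviation partial_x2 :: "(real ^ 2 \<Rightarrow> real) \<Rightarrow> real ^ 2 \<Rightarrow> real" where
  "partial_x2 \<equiv> partial 1"

abbreviation partial_x3 :: "(real ^ 2 \<Rightarrow> real) \<Rightarrow> real ^ 2 \<Rightarrow> real" where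
  "partial_x3 \<equiv> partial 2"

abbreviation e3 :: "real ^ 2" where
  "e3 \<equiv> axis 2 1"

definition grad :: "(real ^ 2 \<Rightarrow> real) \<Rightarrow> real ^ 2 \<Rightarrow> real ^ 2" where
  "grad u x = vector [partial_x2 u x, partial_x3 u x]"

definition divergence :: "(real ^ 2 \<Rightarrow> real ^ 2) \<Rightarrow> real ^ 2 \<Rightarrow> real" where
  "divergence X x = (\<Sum>i\<in>UNIV. partial i (\<lambda>y. X y $ i) x)"

text \<open>The norm of \<open>real ^ 2 ^ 2\<close> is the Frobenius norm.\<close>

definition Hess :: "(real ^ 2 \<Rightarrow> real) \<Rightarrow> real ^ 2 \<Rightarrow> real ^ 2 ^ 2" where
  "Hess u x = (\<chi> i j. partial i (partial j u) x)"

text \<open>\<open>Ck_on k f S\<close>: for open \<open>S\<close>, \<open>f\<close> is $k$ times continuously differentiable on \<open>S\<close>.\<close>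

primrec Ck_on :: "nat \<Rightarrow> (real ^ 2 \<Rightarrow> real) \<Rightarrow> (real ^ 2) set \<Rightarrow> bool" where
  "Ck_on 0 f S \<longleftrightarrow> continuous_on S f"
| "Ck_on (Suc k) f S \<longleftrightarrow> f differentiable_on S \<and> (\<forall>i. Ck_on k (partial i f) S)"

definition smooth_on :: "(real ^ 2 \<Rightarrow> real) \<Rightarrow> (real ^ 2) set \<Rightarrow> bool" where
  "smooth_on f S \<longleftrightarrow> (\<forall>k. Ck_on k f S)"

definition translating_soliton_on :: "(real ^ 2) set \<Rightarrow> (real ^ 2 \<Rightarrow> real) \<Rightarrow> bool" where
  "translating_soliton_on \<Omega> u \<longleftrightarrow>
     smooth_on u \<Omega> \<and>
     (\<forall>x\<in>\<Omega>. divergence (\<lambda>y. grad u y /\<^sub>R sqrt (1 + (norm (grad u y))\<^sup>2)) x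
            = - partial_x3 u x / sqrt (1 + (norm (grad u x))\<^sup>2))"

definition sup_norm_on :: "(real ^ 2) set \<Rightarrow> (real ^ 2 \<Rightarrow> real) \<Rightarrow> real" where
  "sup_norm_on \<Omega> u = (SUP x\<in>\<Omega>. \<bar>u x\<bar>)"

text \<open>
  Extended-real distances: unlike \<open>infdist\<close> and \<open>setdist\<close>, which return \<open>0\<close> for the empty set,
  these return \<open>\<infinity>\<close>. Since \<open>ereal c / \<infinity> = 0\<close>, a bound \<open>ereal c / point_set_dist p {}\<close> is \<open>0\<close>.
\<close>

definition point_set_dist :: "real ^ 2 \<Rightarrow> (real ^ 2) set \<Rightarrow> ereal" where
  "point_set_dist p A = (INF a\<in>A. ereal (dist p a))"

definition set_set_dist :: "(real ^ 2) set \<Rightarrow> (real ^ 2) set \<Rightarrow> ereal" where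
  "set_set_dist A B = (INF a\<in>A. point_set_dist a B)"

lemma point_set_dist_empty [simp]: "point_set_dist p {} = \<infinity>"
  by (simp add: point_set_dist_def top_ereal_def)

lemma point_set_dist_nonempty:
  assumes "A \<noteq> {}"
  shows "point_set_dist p A = ereal (infdist p A)"
proof -
  have "ereal (INF a\<in>A. dist p a) = (INF a\<in>A. ereal (dist p a))"
    using assms by (intro ereal_Inf'[of "dist p ` A", unfolded image_image])
      (auto intro!: bdd_belowI[of _ 0])
  then show ?thesis
    using assms by (simp add: point_set_dist_def infdist_def)
qed

definition upward_sausage :: "real \<Rightarrow> real ^ 2 \<Rightarrow> (real ^ 2) set" where
  "upward_sausage \<rho> p = (\<Union>t\<in>{0..<\<rho>\<^sup>2}. (\<lambda>x. x + t *\<^sub>R e3) ` ball p \<rho>)"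

definition upward_sausages_property :: "(real ^ 2) set \<Rightarrow> bool" where
  "upward_sausages_property \<Omega> \<longleftrightarrow>
     frontier \<Omega> = {} \<or> (\<forall>p\<in>\<Omega>. upward_sausage (infdist p (frontier \<Omega>)) p \<subseteq> \<Omega>)"

end

theory Submission
  imports Defs
begin

text \<open>
The proof uses only the maximum principle for the drift operator
$L f = a_{ij}\,\partial_{ij} f + \partial_3 f$, where $a = I - m \otimes m$ is the inverse of the
induced metric, $m = \nu\nabla u$ and $\nu = (1+|\nabla u|^2)^{-1/2}$. On the graph of a translating
soliton, $L$ is the Laplacian plus derivation along the tangential part of the velocity, and the
basic quantities satisfy
\[
  L u = 0,\qquad L\nu = -S\nu,\qquad 2 S\,(L S + 2 S^2) \ge |\nabla S|_a^2 ,
\]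
where $S = |A|^2$ is the squared norm of the second fundamental form. The first two are the
equation and its first derivatives (\<open>L_u\<close>, \<open>L_\<nu>\<close>); the last is Simons' identity followed by the
Cauchy-Schwarz inequality (\<open>L_S\<close>, \<open>\<Gamma>_S_le\<close>). Since also $|\nabla\nu|_a^2 \le S(1-\nu^2)$
(\<open>\<Gamma>_\<nu>_le\<close>), three interior estimates follow by evaluating $L$ at an interior maximum of a
localised quantity.

  \<^item> Gradient bound at a fixed scale (\<open>interior_gradient_estimate\<close>). The function $1/\nu$ is
    multiplied by an exponential of a cutoff that contains $u$ itself. A steep graph would make
    $L$ of this weight positive at the maximum.
  \<^item> Gradient decay (\<open>interior_gradient_decay\<close>). The operator $L$ behaves like a backward heat
    operator with time $x_3$, so the natural domains of size $R$ are the boxes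
    $|x_2| \le R$, $-R \le x_3 \le R^2$. As $L(u^2) = 2(1-\nu^2)$ has a good sign, $u^2/R^2$
    compensates all error terms produced by a cutoff $\varphi$ in $\varphi^2(1-\nu)$, and
    $1 - \nu \le C/R^2$.
  \<^item> Curvature decay (\<open>interior_curvature_estimate\<close>). The quotient $\varphi^2 S/(\nu-k)^2$ is the
    curvature quantity of Ecker and Huisken. If $1-\nu$ is at most of order $1/R^2$, the constant
    $k$ can be chosen so that $\nu - k$ is comparable with $1/R^2$, and this gives
    $S \le C/R^4$.

Hence $|\operatorname{Hess} u| \le C/R^2$ whenever the box of size $R$ fits into the domain
(\<open>hessian_estimate\<close>). At a point at distance $d \ge 1$ from the boundary the disc of radius $d$
contains the box with $R = \sqrt d/2$, and the upward sausage contains the box with $R = d/2$;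
these two values of $R$ give the exponents one and two of $d$. If the boundary is empty, $R$ is
arbitrary and the Hessian vanishes.
\<close>

section \<open>Smooth functions on a planar domain\<close>

lemma partial_has_derivative:
  assumes "(f has_derivative f') (at x)"
  shows "partial i f x = f' (axis i 1)"
  using frechet_derivative_at[OF assms] by (simp add: partial_def)

lemma smooth_on_differentiable_on: "smooth_on f S \<Longrightarrow> f differentiable_on S"
  unfolding smooth_on_def by (metis Ck_on.simps(2))

lemma smooth_on_partial [intro]: "smooth_on f S \<Longrightarrow> smooth_on (partial i f) S"
  unfolding smooth_on_def by (metis Ck_on.simps(2))

lemma smooth_on_continuous_on: "smooth_on f S \<Longrightarrow> continuous_on S f"
  unfolding smooth_on_def by (metis Ck_on.simps(1))

lemma Ck_on_SucD: "Ck_on (Suc k) f S \<Longrightarrow> Ck_on k f S"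
proof (induction k arbitrary: f)
  case 0
  then show ?case using differentiable_imp_continuous_on by auto
next
  case (Suc k)
  have "Ck_on k (partial i f) S" for i
    using Suc.prems by (intro Suc.IH) simp
  then show ?case using Suc.prems by simp
qed

locale planar_domain =
  fixes \<Omega> :: "(real ^ 2) set"
  assumes open_domain: "open \<Omega>"
begin

lemma differentiable_on_iff: "f differentiable_on \<Omega> \<longleftrightarrow> (\<forall>x\<in>\<Omega>. f differentiable (at x))"
  by (simp add: differentiable_on_def at_within_open[OF _ open_domain])

lemma has_derivative_frechet:
  assumes "f differentiable_on \<Omega>" "x \<in> \<Omega>"
  shows "(f has_derivative frechet_derivative f (at x)) (at x)"
  using assms by (auto simp: differentiable_on_iff frechet_derivative_works)

lemma partial_cong:
  assumes "x \<in> \<Omega>" "\<And>y. y \<in> \<Omega> \<Longrightarrow> f y = g y"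
  shows "partial i f x = partial i g x"
proof -
  have "(f has_derivative D) (at x) \<longleftrightarrow> (g has_derivative D) (at x)" for D
    using has_derivative_transform_within_open[OF _ open_domain assms(1), of f D UNIV g]
      has_derivative_transform_within_open[OF _ open_domain assms(1), of g D UNIV f] assms(2)
    by auto
  then show ?thesis by (simp add: partial_def frechet_derivative_def)
qed

lemma Ck_on_cong:
  assumes "\<And>y. y \<in> \<Omega> \<Longrightarrow> f y = g y" "Ck_on k f \<Omega>"
  shows "Ck_on k g \<Omega>"
  using assms
proof (induction k arbitrary: f g)
  case 0
  then show ?case using continuous_on_cong by force
next
  case (Suc k)
  have "g differentiable_on \<Omega>"
    unfolding differentiable_on_def
  proof
    fix y assume "y \<in> \<Omega>"
    with Suc.prems show "g differentiable (at y within \<Omega>)"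
      by (intro differentiable_transform_within[of f y \<Omega> 1 g]) (auto simp: differentiable_on_def)
  qed
  moreover have "Ck_on k (partial i g) \<Omega>" for i
    using Suc.IH[of "partial i f" "partial i g"] partial_cong Suc.prems by (metis Ck_on.simps(2))
  ultimately show ?case by simp
qed

lemma partial_const [simp]: "partial i (\<lambda>x. c) x = 0"
  by (subst partial_has_derivative[where f' = "\<lambda>_. 0"]) auto

lemma partial_component [simp]: "partial i (\<lambda>x. x $ j) x = (if i = j then 1 else 0)"
  by (subst partial_has_derivative[OF bounded_linear_imp_has_derivative[OF bounded_linear_vec_nth]])
    (auto simp: axis_def)

lemma partial_add_diff:
  assumes "f differentiable_on \<Omega>" "g differentiable_on \<Omega>" "x \<in> \<Omega>"
  shows "partial i (\<lambda>x. f x + g x) x = partial i f x + partial i g x"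
  using has_derivative_add[OF has_derivative_frechet[OF assms(1,3)] has_derivative_frechet[OF assms(2,3)]]
  by (subst partial_has_derivative, assumption) (simp add: partial_def)

lemma partial_mult_diff:
  assumes "f differentiable_on \<Omega>" "g differentiable_on \<Omega>" "x \<in> \<Omega>"
  shows "partial i (\<lambda>x. f x * g x) x = f x * partial i g x + partial i f x * g x"
  using has_derivative_mult[OF has_derivative_frechet[OF assms(1,3)] has_derivative_frechet[OF assms(2,3)]]
  by (subst partial_has_derivative, assumption) (simp add: partial_def)

lemma has_derivative_compose_real:
  assumes "f differentiable_on \<Omega>" "x \<in> \<Omega>" "(\<psi> has_real_derivative d) (at (f x))"
  shows "((\<lambda>x. \<psi> (f x)) has_derivative (\<lambda>v. d * frechet_derivative f (at x) v)) (at x)"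
  using has_derivative_compose[OF has_derivative_frechet[OF assms(1,2)]
      assms(3)[unfolded has_field_derivative_def]] by simp

lemma partial_compose_diff:
  assumes "f differentiable_on \<Omega>" "x \<in> \<Omega>" "(\<psi> has_real_derivative d) (at (f x))"
  shows "partial i (\<lambda>x. \<psi> (f x)) x = d * partial i f x"
  using partial_has_derivative[OF has_derivative_compose_real[OF assms]] by (simp add: partial_def)

lemma Ck_on_const: "Ck_on k (\<lambda>x. c) \<Omega>"
proof (induction k arbitrary: c)
  case (Suc k)
  have "partial i (\<lambda>x. c) = (\<lambda>x. 0)" for i by auto
  with Suc show ?case by simp
qed auto

lemma Ck_on_add: "Ck_on k f \<Omega> \<Longrightarrow> Ck_on k g \<Omega> \<Longrightarrow> Ck_on k (\<lambda>x. f x + g x) \<Omega>"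
proof (induction k arbitrary: f g)
  case (Suc k)
  have "Ck_on k (partial i (\<lambda>x. f x + g x)) \<Omega>" for i
    by (rule Ck_on_cong[of "\<lambda>x. partial i f x + partial i g x"])
      (use Suc in \<open>auto simp: partial_add_diff\<close>)
  with Suc.prems show ?case by (simp add: differentiable_on_add)
qed (auto intro: continuous_intros)

lemma Ck_on_mult: "Ck_on k f \<Omega> \<Longrightarrow> Ck_on k g \<Omega> \<Longrightarrow> Ck_on k (\<lambda>x. f x * g x) \<Omega>"
proof (induction k arbitrary: f g)
  case (Suc k)
  have "Ck_on k (partial i (\<lambda>x. f x * g x)) \<Omega>" for i
    by (rule Ck_on_cong[of "\<lambda>x. f x * partial i g x + partial i f x * g x"],
        use Suc.prems in \<open>simp add: partial_mult_diff\<close>,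
        intro Ck_on_add Suc.IH)
      (use Suc.prems Ck_on_SucD in auto)
  with Suc.prems show ?case by (simp add: differentiable_on_mult)
qed (auto intro: continuous_intros)

lemma smooth_on_const [intro!, simp]: "smooth_on (\<lambda>x. c) \<Omega>"
  unfolding smooth_on_def using Ck_on_const by blast

lemma smooth_on_component [intro!, simp]: "smooth_on (\<lambda>x. x $ j) \<Omega>"
proof -
  have "Ck_on k (\<lambda>x. x $ j) \<Omega>" for k
  proof (induction k)
    case 0
    show ?case by (auto intro: continuous_intros)
  next
    case (Suc k)
    have "partial i (\<lambda>x. x $ j) = (\<lambda>x. if i = j then 1 else 0)" for i by (rule ext) simp
    moreover have "(\<lambda>x. x $ j) differentiable_on \<Omega>"
      by (simp add: bounded_linear_imp_differentiable_on bounded_linear_vec_nth)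
    ultimately show ?case by (simp add: Ck_on_const)
  qed
  then show ?thesis by (simp add: smooth_on_def)
qed

lemma smooth_on_add [intro!, simp]: "smooth_on f \<Omega> \<Longrightarrow> smooth_on g \<Omega> \<Longrightarrow> smooth_on (\<lambda>x. f x + g x) \<Omega>"
  unfolding smooth_on_def using Ck_on_add by blast

lemma smooth_on_mult [intro!, simp]: "smooth_on f \<Omega> \<Longrightarrow> smooth_on g \<Omega> \<Longrightarrow> smooth_on (\<lambda>x. f x * g x) \<Omega>"
  unfolding smooth_on_def using Ck_on_mult by blast

lemma smooth_on_minus [intro!, simp]: "smooth_on f \<Omega> \<Longrightarrow> smooth_on (\<lambda>x. - f x) \<Omega>"
  using smooth_on_mult[of "\<lambda>_. -1" f] by simp

lemma smooth_on_diff [intro!, simp]: "smooth_on f \<Omega> \<Longrightarrow> smooth_on g \<Omega> \<Longrightarrow> smooth_on (\<lambda>x. f x - g x) \<Omega>"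
  using smooth_on_add[of f "\<lambda>x. - g x"] by simp

lemma smooth_on_power [intro!, simp]: "smooth_on f \<Omega> \<Longrightarrow> smooth_on (\<lambda>x. f x ^ n) \<Omega>"
  by (induction n) auto

text \<open>
All derivatives of the outer function are needed at once, because the derivative of
$\psi_n\circ f$ is $\psi_{n+1}\circ f$ times a derivative of $f$. The outer function is therefore
given together with its derivatives, as the sequence $\psi$.
\<close>

lemma smooth_on_compose:
  assumes "smooth_on f \<Omega>"
    and "\<And>n t. t \<in> f ` \<Omega> \<Longrightarrow> (\<psi> n has_real_derivative \<psi> (Suc n) t) (at t)"
  shows "smooth_on (\<lambda>x. \<psi> n (f x)) \<Omega>"
proof -
  have f: "f differentiable_on \<Omega>" using assms(1) by (rule smooth_on_differentiable_on)
  have d: "(\<lambda>x. \<psi> n (f x)) differentiable_on \<Omega>" for n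
    unfolding differentiable_on_iff
    using has_derivative_compose_real[OF f _ assms(2)] by (auto simp: differentiable_def)
  have "Ck_on k (\<lambda>x. \<psi> n (f x)) \<Omega>" for k
  proof (induction k arbitrary: n)
    case 0
    show ?case using d by (simp add: differentiable_imp_continuous_on)
  next
    case (Suc k)
    have "Ck_on k (partial i (\<lambda>x. \<psi> n (f x))) \<Omega>" for i
    proof (rule Ck_on_cong[of "\<lambda>x. \<psi> (Suc n) (f x) * partial i f x"])
      show "Ck_on k (\<lambda>x. \<psi> (Suc n) (f x) * partial i f x) \<Omega>"
        using assms(1) Suc.IH smooth_on_partial by (intro Ck_on_mult) (auto simp: smooth_on_def)
      show "\<psi> (Suc n) (f y) * partial i f y = partial i (\<lambda>x. \<psi> n (f x)) y" if "y \<in> \<Omega>" for y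
        using that by (simp add: partial_compose_diff[OF f that assms(2)])
    qed
    then show ?case using d by simp
  qed
  then show ?thesis by (simp add: smooth_on_def)
qed

lemma smooth_on_exp [intro!, simp]: "smooth_on f \<Omega> \<Longrightarrow> smooth_on (\<lambda>x. exp (f x)) \<Omega>"
  by (rule smooth_on_compose[where \<psi> = "\<lambda>_. exp"]) auto

lemma smooth_on_powr:
  assumes "smooth_on f \<Omega>" "\<And>x. x \<in> \<Omega> \<Longrightarrow> f x > 0"
  shows "smooth_on (\<lambda>x. f x powr r) \<Omega>"
proof -
  define \<psi> where "\<psi> n t = (\<Prod>j<n. r - real j) * t powr (r - real n)" for n and t :: real
  have "(\<psi> n has_real_derivative \<psi> (Suc n) t) (at t)" if "t \<in> f ` \<Omega>" for n t
  proof -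
    have "t > 0" using that assms(2) by auto
    then show ?thesis unfolding \<psi>_def
      by (auto intro!: derivative_eq_intros simp: algebra_simps)
  qed
  from smooth_on_compose[where \<psi> = \<psi> and n = 0, OF assms(1) this]
  show ?thesis by (simp add: \<psi>_def)
qed

context
  notes [simp] = smooth_on_differentiable_on
begin

lemma partial_add: "smooth_on f \<Omega> \<Longrightarrow> smooth_on g \<Omega> \<Longrightarrow> x \<in> \<Omega> \<Longrightarrow>
    partial i (\<lambda>x. f x + g x) x = partial i f x + partial i g x"
  by (simp add: partial_add_diff)

lemma partial_mult: "smooth_on f \<Omega> \<Longrightarrow> smooth_on g \<Omega> \<Longrightarrow> x \<in> \<Omega> \<Longrightarrow>
    partial i (\<lambda>x. f x * g x) x = f x * partial i g x + partial i f x * g x"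
  by (simp add: partial_mult_diff)

lemma partial_minus: "smooth_on f \<Omega> \<Longrightarrow> x \<in> \<Omega> \<Longrightarrow> partial i (\<lambda>x. - f x) x = - partial i f x"
  using partial_mult[of "\<lambda>_. -1" f] by simp

lemma partial_diff: "smooth_on f \<Omega> \<Longrightarrow> smooth_on g \<Omega> \<Longrightarrow> x \<in> \<Omega> \<Longrightarrow>
    partial i (\<lambda>x. f x - g x) x = partial i f x - partial i g x"
  using partial_add[of f "\<lambda>x. - g x"] by (simp add: partial_minus)

lemma partial_power2: "smooth_on f \<Omega> \<Longrightarrow> x \<in> \<Omega> \<Longrightarrow>
    partial i (\<lambda>x. (f x)\<^sup>2) x = 2 * f x * partial i f x"
  using partial_mult[of f f] by (simp add: power2_eq_square)

lemma partial_exp: "smooth_on f \<Omega> \<Longrightarrow> x \<in> \<Omega> \<Longrightarrow>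
    partial i (\<lambda>x. exp (f x)) x = exp (f x) * partial i f x"
  by (rule partial_compose_diff) auto

end

lemmas partial_rules = partial_add partial_mult partial_minus partial_diff partial_power2 partial_exp

lemma DERIV_along_line:
  assumes "f differentiable_on \<Omega>" "x + t *\<^sub>R v \<in> \<Omega>"
  shows "((\<lambda>t. f (x + t *\<^sub>R v)) has_real_derivative
      partial 1 f (x + t *\<^sub>R v) * v $ 1 + partial 2 f (x + t *\<^sub>R v) * v $ 2) (at t)"
proof -
  let ?y = "x + t *\<^sub>R v"
  let ?D = "frechet_derivative f (at ?y)"
  have D: "(f has_derivative ?D) (at ?y)" using assms by (rule has_derivative_frechet)
  have l: "((\<lambda>t. x + t *\<^sub>R v) has_derivative (\<lambda>s. s *\<^sub>R v)) (at t)"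
    by (auto intro!: derivative_eq_intros)
  have "((\<lambda>t. f (x + t *\<^sub>R v)) has_derivative (\<lambda>s. ?D (s *\<^sub>R v))) (at t)"
    using has_derivative_compose[OF l D] .
  moreover have "?D (s *\<^sub>R v) = (partial 1 f ?y * v $ 1 + partial 2 f ?y * v $ 2) * s" for s
  proof -
    interpret bounded_linear ?D using D by (rule has_derivative_bounded_linear)
    have "v = v $ 1 *\<^sub>R axis 1 1 + v $ 2 *\<^sub>R axis 2 1"
      by (simp add: vec_eq_iff forall_2 axis_def)
    then have "?D v = v $ 1 *\<^sub>R ?D (axis 1 1) + v $ 2 *\<^sub>R ?D (axis 2 1)"
      by (metis add scaleR)
    then show ?thesis by (simp add: scaleR partial_def algebra_simps)
  qed
  ultimately show ?thesis by (simp add: has_field_derivative_def)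
qed

lemma DERIV_along_axis:
  assumes "f differentiable_on \<Omega>" "x + t *\<^sub>R axis i 1 \<in> \<Omega>"
  shows "((\<lambda>t. f (x + t *\<^sub>R axis i 1)) has_real_derivative partial i f (x + t *\<^sub>R axis i 1)) (at t)"
  using DERIV_along_line[OF assms] exhaust_2[of i] by (auto simp: axis_def)

text \<open>
Two applications of the mean value theorem, first along one axis and then along the other. The
left-hand side is symmetric in the two axes, which is why mixed partial derivatives commute.
\<close>

lemma second_difference:
  fixes f :: "real ^ 2 \<Rightarrow> real" and i j :: 2
  assumes f: "smooth_on f \<Omega>" and s: "s > 0" and B: "ball x (3 * s) \<subseteq> \<Omega>"
  obtains y where "y \<in> ball x (3 * s)"
    "f (x + s *\<^sub>R axis i 1 + s *\<^sub>R axis j 1) - f (x + s *\<^sub>R axis i 1) - f (x + s *\<^sub>R axis j 1) + f x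
      = s * s * partial j (partial i f) y"
proof -
  have mem: "x + a *\<^sub>R axis i 1 + b *\<^sub>R axis j 1 \<in> ball x (3 * s)"
    if "0 \<le> a" "a \<le> s" "0 \<le> b" "b \<le> s" for a b
  proof -
    have "norm (a *\<^sub>R axis i 1 + b *\<^sub>R axis j 1 :: real ^ 2) \<le> a + b"
      using norm_triangle_ineq[of "a *\<^sub>R axis i (1::real)" "b *\<^sub>R axis j 1"] that by (simp add: norm_axis_1)
    moreover have "dist x (x + a *\<^sub>R axis i 1 + b *\<^sub>R axis j 1)
        = norm (a *\<^sub>R axis i 1 + b *\<^sub>R axis j 1 :: real ^ 2)"
      by (metis add.assoc add_diff_cancel_left' dist_commute dist_norm)
    ultimately show ?thesis using that s by simp
  qed
  let ?g = "\<lambda>a. f (x + s *\<^sub>R axis j 1 + a *\<^sub>R axis i 1) - f (x + a *\<^sub>R axis i 1)"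
  let ?g' = "\<lambda>a. partial i f (x + s *\<^sub>R axis j 1 + a *\<^sub>R axis i 1) - partial i f (x + a *\<^sub>R axis i 1)"
  have d: "smooth_on h \<Omega> \<Longrightarrow> h differentiable_on \<Omega>" for h by (rule smooth_on_differentiable_on)
  have "\<exists>a>0. a < s \<and> ?g s - ?g 0 = (s - 0) * ?g' a"
  proof (rule MVT2[OF s])
    fix a assume a: "0 \<le> a" "a \<le> s"
    have "x + s *\<^sub>R axis j 1 + a *\<^sub>R axis i 1 \<in> \<Omega>" "x + a *\<^sub>R axis i 1 \<in> \<Omega>"
      using mem[of a s] mem[of a 0] a s B by (auto simp: add_ac)
    then show "DERIV ?g a :> ?g' a"
      by (intro DERIV_diff DERIV_along_axis d[OF f])
  qed
  then obtain a where a: "0 < a" "a < s" "?g s - ?g 0 = s * ?g' a" by auto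
  let ?k = "\<lambda>b. partial i f (x + a *\<^sub>R axis i 1 + b *\<^sub>R axis j 1)"
  have "\<exists>b>0. b < s \<and> ?k s - ?k 0 = (s - 0) * partial j (partial i f) (x + a *\<^sub>R axis i 1 + b *\<^sub>R axis j 1)"
  proof (rule MVT2[OF s])
    fix b assume b: "0 \<le> b" "b \<le> s"
    have "x + a *\<^sub>R axis i 1 + b *\<^sub>R axis j 1 \<in> \<Omega>"
      using mem[of a b] a b B by auto
    then show "DERIV ?k b :> partial j (partial i f) (x + a *\<^sub>R axis i 1 + b *\<^sub>R axis j 1)"
      by (intro DERIV_along_axis d smooth_on_partial f)
  qed
  then obtain b where b: "0 < b" "b < s"
    "?k s - ?k 0 = s * partial j (partial i f) (x + a *\<^sub>R axis i 1 + b *\<^sub>R axis j 1)" by auto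
  show ?thesis
  proof
    show "x + a *\<^sub>R axis i 1 + b *\<^sub>R axis j 1 \<in> ball x (3 * s)" using mem a b by simp
    have "?g' a = ?k s - ?k 0" by (simp add: add_ac)
    then show "f (x + s *\<^sub>R axis i 1 + s *\<^sub>R axis j 1) - f (x + s *\<^sub>R axis i 1) - f (x + s *\<^sub>R axis j 1) + f x
      = s * s * partial j (partial i f) (x + a *\<^sub>R axis i 1 + b *\<^sub>R axis j 1)"
      using a(3) b(3) by (simp add: add_ac)
  qed
qed

lemma partial_commute:
  fixes f :: "real ^ 2 \<Rightarrow> real" and i j :: 2
  assumes f: "smooth_on f \<Omega>" and x: "x \<in> \<Omega>"
  shows "partial i (partial j f) x = partial j (partial i f) x"
proof (rule ccontr)
  let ?A = "partial i (partial j f)" and ?B = "partial j (partial i f)"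
  assume ne: "?A x \<noteq> ?B x"
  define e where "e = \<bar>?A x - ?B x\<bar> / 2"
  have e: "e > 0" using ne by (simp add: e_def)
  have cont: "isCont ?A x" "isCont ?B x"
    using smooth_on_continuous_on[OF smooth_on_partial[OF smooth_on_partial[OF f]]] x
    by (auto simp: continuous_on_eq_continuous_at[OF open_domain])
  obtain d1 where d1: "d1 > 0" "\<And>y. dist y x < d1 \<Longrightarrow> \<bar>?A y - ?A x\<bar> < e"
    using cont(1)[unfolded continuous_at_eps_delta] e by (auto simp: dist_real_def)
  obtain d2 where d2: "d2 > 0" "\<And>y. dist y x < d2 \<Longrightarrow> \<bar>?B y - ?B x\<bar> < e"
    using cont(2)[unfolded continuous_at_eps_delta] e by (auto simp: dist_real_def)
  obtain d3 where d3: "d3 > 0" "ball x d3 \<subseteq> \<Omega>"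
    using open_domain x open_contains_ball by blast
  define s where "s = min d1 (min d2 d3) / 3"
  have s: "s > 0" "3 * s \<le> d1" "3 * s \<le> d2" "3 * s \<le> d3" using d1 d2 d3 by (auto simp: s_def)
  have B: "ball x (3 * s) \<subseteq> \<Omega>" using d3 s by force
  obtain y where y: "y \<in> ball x (3 * s)"
    "f (x + s *\<^sub>R axis i 1 + s *\<^sub>R axis j 1) - f (x + s *\<^sub>R axis i 1) - f (x + s *\<^sub>R axis j 1) + f x
      = s * s * ?B y"
    using second_difference[OF f s(1) B] by blast
  obtain z where z: "z \<in> ball x (3 * s)"
    "f (x + s *\<^sub>R axis j 1 + s *\<^sub>R axis i 1) - f (x + s *\<^sub>R axis j 1) - f (x + s *\<^sub>R axis i 1) + f x
      = s * s * ?A z"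
    using second_difference[OF f s(1) B] by blast
  have "f (x + s *\<^sub>R axis j 1 + s *\<^sub>R axis i 1) = f (x + s *\<^sub>R axis i 1 + s *\<^sub>R axis j 1)"
    by (simp add: add_ac)
  then have "s * s * ?A z = s * s * ?B y" using y(2) z(2) by linarith
  then have "?A z = ?B y" using s by simp
  moreover have "\<bar>?A z - ?A x\<bar> < e" "\<bar>?B y - ?B x\<bar> < e"
    using d1(2)[of z] d2(2)[of y] y(1) z(1) s by (auto simp: dist_commute)
  ultimately show False unfolding e_def by (simp add: abs_if split: if_splits)
qed

lemma interior_maximum_gradient:
  assumes f: "smooth_on f \<Omega>" and d: "d > 0" "ball x d \<subseteq> \<Omega>"
    and max: "\<And>y. y \<in> ball x d \<Longrightarrow> f y \<le> f x"
  shows "partial i f x = 0"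
proof (rule DERIV_local_max[OF _ d(1)])
  show "((\<lambda>t. f (x + t *\<^sub>R axis i 1)) has_real_derivative partial i f x) (at 0)"
    using DERIV_along_axis[OF smooth_on_differentiable_on[OF f], of x 0 i] d centre_in_ball[of x d]
    by (simp add: subset_iff del: centre_in_ball)
  show "\<forall>t. \<bar>0 - t\<bar> < d \<longrightarrow> f (x + t *\<^sub>R axis i 1) \<le> f (x + 0 *\<^sub>R axis i 1)"
    using max by (auto simp: dist_norm norm_axis_1)
qed

text \<open>
If the second derivative along a line were positive, the first derivative, which vanishes at the
maximum, would be positive just after it.
\<close>

lemma interior_maximum_hessian:
  fixes v :: "real ^ 2"
  assumes f: "smooth_on f \<Omega>" and d: "d > 0" "ball x d \<subseteq> \<Omega>"
    and max: "\<And>y. y \<in> ball x d \<Longrightarrow> f y \<le> f x"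
  shows "partial 1 (partial 1 f) x * (v $ 1)\<^sup>2 + 2 * partial 1 (partial 2 f) x * (v $ 1) * (v $ 2)
          + partial 2 (partial 2 f) x * (v $ 2)\<^sup>2 \<le> 0" (is "?H \<le> 0")
proof (rule ccontr)
  assume "\<not> ?H \<le> 0"
  then have pos: "?H > 0" by simp
  have v: "norm v > 0" using pos by (cases "v = 0") auto
  let ?y = "\<lambda>t. x + t *\<^sub>R v"
  let ?g' = "\<lambda>t. partial 1 f (?y t) * v $ 1 + partial 2 f (?y t) * v $ 2"
  have x: "x \<in> \<Omega>" using d by auto
  have sd: "smooth_on h \<Omega> \<Longrightarrow> h differentiable_on \<Omega>" for h by (rule smooth_on_differentiable_on)
  have inball: "?y t \<in> ball x d" if "\<bar>t\<bar> < d / norm v" for t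
    using that v by (simp add: dist_norm field_simps)
  have "(?g' has_real_derivative
      (partial 1 (partial 1 f) (?y 0) * v $ 1 + partial 2 (partial 1 f) (?y 0) * v $ 2) * v $ 1 +
      (partial 1 (partial 2 f) (?y 0) * v $ 1 + partial 2 (partial 2 f) (?y 0) * v $ 2) * v $ 2) (at 0)"
    using x f by (intro DERIV_add DERIV_cmult_right DERIV_along_line sd smooth_on_partial) auto
  then have "(?g' has_real_derivative ?H) (at 0)"
    using partial_commute[OF f x, of 2 1] by (simp add: power2_eq_square algebra_simps)
  from DERIV_pos_inc_right[OF this pos]
  obtain e where e: "e > 0" "\<And>h. 0 < h \<Longrightarrow> h < e \<Longrightarrow> ?g' 0 < ?g' h" by auto
  have g0: "?g' 0 = 0" using interior_maximum_gradient[OF f d max] by simp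
  define s where "s = min e (d / norm v) / 2"
  have s: "s > 0" "s < e" "s < d / norm v" using e d v by (auto simp: s_def min_def field_simps)
  have "\<exists>t>0. t < s \<and> f (?y s) - f (?y 0) = (s - 0) * ?g' t"
    using inball d s by (intro MVT2 DERIV_along_line sd f) auto
  then obtain t where "0 < t" "t < s" "f (?y s) - f x = s * ?g' t" by auto
  then have "f (?y s) > f x" using e(2)[of t] g0 s by (smt (verit) mult_pos_pos)
  with max[OF inball[of s]] s show False by auto
qed

end

section \<open>Geometry of a translating graph\<close>

lemma quadratic_nonneg_discriminant:
  fixes a b c :: real
  assumes "a \<ge> 0" "\<And>t. a * t\<^sup>2 + 2 * b * t + c \<ge> 0"
  shows "b\<^sup>2 \<le> a * c"
proof (cases "a = 0")
  case True
  show ?thesis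
  proof (cases "b = 0")
    case False
    have "2 * b * (- (c + 1) / (2 * b)) + c = -1" using False by (simp add: field_simps)
    with assms(2)[of "- (c + 1) / (2 * b)"] True show ?thesis by simp
  qed (use True in simp)
next
  case False
  with assms(1) have a: "a > 0" by simp
  have "a * (a * (- b / a)\<^sup>2 + 2 * b * (- b / a) + c) \<ge> 0"
    using a assms(2)[of "- b / a"] by (intro mult_nonneg_nonneg) linarith+
  moreover have "a * (a * (- b / a)\<^sup>2 + 2 * b * (- b / a) + c) = a * c - b\<^sup>2"
    using a by (simp add: field_simps power2_eq_square)
  ultimately show ?thesis by simp
qed

locale soliton = planar_domain +
  fixes u :: "real ^ 2 \<Rightarrow> real"
  assumes soliton: "translating_soliton_on \<Omega> u"
begin

lemma smooth_u [intro!, simp]: "smooth_on u \<Omega>"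
  using soliton by (simp add: translating_soliton_on_def)

declare smooth_on_partial [simp]

text \<open>
The component in the direction of the values of $u$ of the unit normal
$(1, -\nabla u)/\sqrt{1+|\nabla u|^2}$ of the graph; the other two components are $-m$.
\<close>

definition \<nu> :: "real ^ 2 \<Rightarrow> real" where
  "\<nu> x = (1 + (partial 1 u x)\<^sup>2 + (partial 2 u x)\<^sup>2) powr (- 1 / 2)"

definition m :: "2 \<Rightarrow> real ^ 2 \<Rightarrow> real" where
  "m i x = \<nu> x * partial i u x"

text \<open>
The second fundamental form of the graph in the coordinates $x_2, x_3$.
\<close>

definition h :: "2 \<Rightarrow> 2 \<Rightarrow> real ^ 2 \<Rightarrow> real" where
  "h i j x = \<nu> x * partial i (partial j u) x"

text \<open>
The covector $hm$; it is minus the logarithmic derivative of \<open>\<nu>\<close>.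
\<close>

definition w :: "2 \<Rightarrow> real ^ 2 \<Rightarrow> real" where
  "w i x = h i 1 x * m 1 x + h i 2 x * m 2 x"

text \<open>
The shape operator, i.e. the second fundamental form with one index raised by the inverse metric
$I - m\otimes m$. It is also the derivative of $m$, because the coordinate tangent vectors
of a graph have the unit vectors of the plane as their horizontal parts.
\<close>

definition b :: "2 \<Rightarrow> 2 \<Rightarrow> real ^ 2 \<Rightarrow> real" where
  "b i j x = h i j x - m i x * w j x"

text \<open>
The covariant derivative of the second fundamental form. The Christoffel symbols of the induced
metric are $m_l h_{ij}$, and \<open>w\<close> collects the terms that they and the factor \<open>\<nu>\<close> produce. By the
Codazzi equation this tensor is symmetric in all its indices.
\<close>

definition T :: "2 \<Rightarrow> 2 \<Rightarrow> 2 \<Rightarrow> real ^ 2 \<Rightarrow> real" where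
  "T i j k x = \<nu> x * partial k (partial i (partial j u)) x
     - h i j x * w k x - h k i x * w j x - h k j x * w i x"

text \<open>
The squared norm of the second fundamental form, as the trace of the squared shape operator.
\<close>

definition S :: "real ^ 2 \<Rightarrow> real" where
  "S x = (b 1 1 x)\<^sup>2 + 2 * (b 1 2 x * b 2 1 x) + (b 2 2 x)\<^sup>2"

text \<open>
The inner product of the gradients of two functions in the induced metric (the carre du champ of
\<open>L\<close>).
\<close>

definition \<Gamma> :: "(real ^ 2 \<Rightarrow> real) \<Rightarrow> (real ^ 2 \<Rightarrow> real) \<Rightarrow> real ^ 2 \<Rightarrow> real" where
  "\<Gamma> f g x = (1 - (m 1 x)\<^sup>2) * (partial 1 f x * partial 1 g x)
     - m 1 x * m 2 x * (partial 1 f x * partial 2 g x + partial 2 f x * partial 1 g x)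
     + (1 - (m 2 x)\<^sup>2) * (partial 2 f x * partial 2 g x)"

text \<open>
The coordinates satisfy $L x_2 = 0$ and $L x_3 = 1$, so in the coordinates of the plane the Laplacian
of the graph together with the drift has no first-order part other than $\partial_3$.
\<close>

definition L :: "(real ^ 2 \<Rightarrow> real) \<Rightarrow> real ^ 2 \<Rightarrow> real" where
  "L f x = (1 - (m 1 x)\<^sup>2) * partial 1 (partial 1 f) x
     - 2 * m 1 x * m 2 x * partial 1 (partial 2 f) x
     + (1 - (m 2 x)\<^sup>2) * partial 2 (partial 2 f) x + partial 2 f x"

lemma one_plus_grad_pos: "1 + (partial 1 u x)\<^sup>2 + (partial 2 u x)\<^sup>2 > 0"
  by (smt (verit) zero_le_power2)

lemma smooth_\<nu> [intro!, simp]: "smooth_on \<nu> \<Omega>"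
  using smooth_on_powr[of "\<lambda>x. 1 + (partial 1 u x)\<^sup>2 + (partial 2 u x)\<^sup>2" "- 1 / 2"] one_plus_grad_pos
  unfolding \<nu>_def[abs_def] by auto

lemma smooth_m [intro!, simp]: "smooth_on (m i) \<Omega>"
  unfolding m_def[abs_def] by simp

lemma smooth_h [intro!, simp]: "smooth_on (h i j) \<Omega>"
  unfolding h_def[abs_def] by simp

lemma smooth_w [intro!, simp]: "smooth_on (w i) \<Omega>"
  unfolding w_def[abs_def] by simp

lemma smooth_b [intro!, simp]: "smooth_on (b i j) \<Omega>"
  unfolding b_def[abs_def] by simp

lemma smooth_S [intro!, simp]: "smooth_on S \<Omega>"
  unfolding S_def[abs_def] by simp

lemma \<nu>_pos: "\<nu> x > 0"
  using one_plus_grad_pos[of x] by (simp add: \<nu>_def)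

lemma \<nu>_square: "(\<nu> x)\<^sup>2 * (1 + (partial 1 u x)\<^sup>2 + (partial 2 u x)\<^sup>2) = 1"
proof -
  have "(\<nu> x)\<^sup>2 = (1 + (partial 1 u x)\<^sup>2 + (partial 2 u x)\<^sup>2) powr (-1)"
    unfolding \<nu>_def power2_eq_square by (simp flip: powr_add)
  then show ?thesis using one_plus_grad_pos[of x] by (simp add: powr_minus)
qed

lemma \<nu>_sqrt: "\<nu> x = 1 / sqrt (1 + (partial 1 u x)\<^sup>2 + (partial 2 u x)\<^sup>2)"
  using one_plus_grad_pos[of x] by (simp add: \<nu>_def powr_minus powr_half_sqrt field_simps)

lemma \<nu>_m: "(\<nu> x)\<^sup>2 = 1 - (m 1 x)\<^sup>2 - (m 2 x)\<^sup>2"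
  using \<nu>_square[of x] by (simp add: m_def power_mult_distrib algebra_simps)

lemma \<nu>_le_1: "\<nu> x \<le> 1"
proof -
  have "(\<nu> x)\<^sup>2 \<le> 1\<^sup>2" using \<nu>_m[of x] zero_le_power2[of "m 1 x"] zero_le_power2[of "m 2 x"] by simp
  then show ?thesis by (rule power2_le_imp_le) simp
qed

lemma partial_commute_21: "smooth_on f \<Omega> \<Longrightarrow> x \<in> \<Omega> \<Longrightarrow> partial 2 (partial 1 f) x = partial 1 (partial 2 f) x"
  by (rule partial_commute)

lemma h_commute: "x \<in> \<Omega> \<Longrightarrow> h 2 1 x = h 1 2 x"
  by (simp add: h_def partial_commute_21)

lemma T_commute:
  assumes "x \<in> \<Omega>"
  shows "T 2 1 k x = T 1 2 k x" "T 1 1 2 x = T 1 2 1 x" "T 2 2 1 x = T 1 2 2 x"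
proof -
  have c: "partial k (partial 2 (partial 1 u)) x = partial k (partial 1 (partial 2 u)) x" for k
    using assms partial_commute_21[OF smooth_u] by (intro partial_cong) auto
  show "T 2 1 k x = T 1 2 k x"
    unfolding T_def c using assms by (simp add: h_commute)
  show "T 1 1 2 x = T 1 2 1 x"
    unfolding T_def using c[of 1] partial_commute_21[of "partial 1 u" x] assms by (simp add: h_commute)
  show "T 2 2 1 x = T 1 2 2 x"
    unfolding T_def using partial_commute_21[of "partial 2 u" x] assms by (simp add: h_commute)
qed

lemma partial_\<nu>:
  assumes "x \<in> \<Omega>"
  shows "partial k \<nu> x = - \<nu> x * w k x"
proof -
  let ?g = "\<lambda>x. 1 + (partial 1 u x)\<^sup>2 + (partial 2 u x)\<^sup>2"
  have "partial k (\<lambda>x. (?g x) powr (- 1 / 2)) x = (- 1 / 2) * (?g x) powr (- 1 / 2 - 1) * partial k ?g x"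
    by (rule partial_compose_diff[OF _ assms has_real_derivative_powr[OF one_plus_grad_pos]])
      (auto intro!: smooth_on_differentiable_on)
  moreover have "partial k ?g x = 2 * partial 1 u x * partial k (partial 1 u) x + 2 * partial 2 u x * partial k (partial 2 u) x"
    using assms by (simp add: partial_rules)
  moreover have "(?g x) powr (- 1 / 2 - 1) = (\<nu> x)^3"
    unfolding \<nu>_def using one_plus_grad_pos[of x] by (subst powr_power) auto
  moreover have "partial k (partial 1 u) x = partial 1 (partial k u) x" "partial k (partial 2 u) x = partial 2 (partial k u) x"
    using assms partial_commute by auto
  ultimately have "partial k \<nu> x = - ((\<nu> x)^3 * (partial 1 u x * partial k (partial 1 u) x + partial 2 u x * partial k (partial 2 u) x))"
    unfolding \<nu>_def[abs_def] by (simp add: algebra_simps)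
  then show ?thesis
    by (simp add: w_def h_def m_def power3_eq_cube algebra_simps)
qed

lemma partial_m:
  assumes "x \<in> \<Omega>"
  shows "partial k (m i) x = b i k x"
proof -
  have "partial k (m i) x = \<nu> x * partial k (partial i u) x + partial k \<nu> x * partial i u x"
    unfolding m_def[abs_def] using assms by (simp add: partial_rules)
  then show ?thesis
    using assms partial_commute[OF smooth_u assms, of k i] by (simp add: partial_\<nu> b_def h_def m_def)
qed

lemma partial_h:
  assumes "x \<in> \<Omega>"
  shows "partial k (h i j) x = T i j k x + h k i x * w j x + h k j x * w i x"
proof -
  have "partial k (h i j) x = \<nu> x * partial k (partial i (partial j u)) x + partial k \<nu> x * partial i (partial j u) x"
    unfolding h_def[abs_def] using assms by (simp add: partial_rules)
  then show ?thesis
    using assms by (simp add: partial_\<nu> T_def h_def algebra_simps)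
qed

lemma partial_w:
  assumes "x \<in> \<Omega>"
  shows "partial k (w i) x = h i 1 x * b 1 k x + partial k (h i 1) x * m 1 x
            + h i 2 x * b 2 k x + partial k (h i 2) x * m 2 x"
  unfolding w_def[abs_def] using assms by (simp add: partial_rules partial_m)

lemma partial_b:
  assumes "x \<in> \<Omega>"
  shows "partial k (b i j) x = partial k (h i j) x - (m i x * partial k (w j) x + b i k x * w j x)"
proof -
  have "partial k (b i j) x = partial k (\<lambda>x. h i j x - m i x * w j x) x" by (simp add: b_def[abs_def])
  then show ?thesis using assms by (simp add: partial_rules partial_m)
qed

lemma partial2_m:
  assumes "x \<in> \<Omega>"
  shows "partial k (partial l (m i)) x = partial k (b i l) x"
  using assms by (intro partial_cong) (auto simp: partial_m)

text \<open>
The trace of the shape operator is the mean curvature, and the soliton equation prescribes it as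
minus the $x_3$-component of $m$.
\<close>

lemma divergence_equation:
  assumes "x \<in> \<Omega>"
  shows "b 1 1 x + b 2 2 x = - m 2 x"
proof -
  have n: "(norm (grad u y))\<^sup>2 = (partial 1 u y)\<^sup>2 + (partial 2 u y)\<^sup>2" for y
    by (simp add: norm_vec_def L2_set_def sum_2 grad_def vector_2)
  have "grad u y $ i = partial i u y" for i y
    using exhaust_2[of i] by (auto simp: grad_def vector_2)
  then have "(\<lambda>y. (grad u y /\<^sub>R sqrt (1 + (norm (grad u y))\<^sup>2)) $ i) = m i" for i
    by (simp add: fun_eq_iff n m_def \<nu>_sqrt divide_inverse add.assoc)
  then have "divergence (\<lambda>y. grad u y /\<^sub>R sqrt (1 + (norm (grad u y))\<^sup>2)) x = partial 1 (m 1) x + partial 2 (m 2) x"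
    by (simp add: divergence_def sum_2)
  then have "b 1 1 x + b 2 2 x = - partial 2 u x / sqrt (1 + (norm (grad u x))\<^sup>2)"
    using soliton assms by (simp add: translating_soliton_on_def partial_m)
  then show ?thesis by (simp add: n m_def \<nu>_sqrt add.assoc)
qed

lemma partial_divergence_equation:
  assumes "x \<in> \<Omega>"
  shows "partial k (b 1 1) x + partial k (b 2 2) x = - b 2 k x"
proof -
  have "partial k (\<lambda>x. b 1 1 x + b 2 2 x) x = partial k (\<lambda>x. - m 2 x) x"
    using assms divergence_equation by (intro partial_cong) auto
  then show ?thesis using assms by (simp add: partial_rules partial_m)
qed

lemmas jets = partial_m partial2_m partial_b partial_w partial_h T_commute h_commute

text \<open>
The horizontal components of the normal are Jacobi functions. This is the derivative of the
soliton equation along the axes, so it is a polynomial identity in $m$, $h$ and \<open>T\<close> once the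
equation and its two first derivatives are given. The same holds for the remaining component
\<open>\<nu>\<close> of the normal.
\<close>

lemma L_m:
  assumes "x \<in> \<Omega>"
  shows "L (m i) x = - S x * m i x"
proof -
  note d = partial_divergence_equation[OF assms, of 1] partial_divergence_equation[OF assms, of 2]
     divergence_equation[OF assms]
  note d' = d[unfolded jets[OF assms] b_def w_def]
  have "L (m 1) x = - S x * m 1 x"
    unfolding L_def S_def jets[OF assms] b_def w_def using d' by algebra
  moreover have "L (m 2) x = - S x * m 2 x"
    unfolding L_def S_def jets[OF assms] b_def w_def using d' by algebra
  ultimately show ?thesis using exhaust_2[of i] by auto
qed

lemma L_cong:
  assumes "x \<in> \<Omega>" "\<And>y. y \<in> \<Omega> \<Longrightarrow> f y = g y"
  shows "L f x = L g x"
proof -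
  have 1: "partial i f y = partial i g y" if "y \<in> \<Omega>" for i y
    using that assms(2) by (rule partial_cong)
  then have "partial i (partial j f) x = partial i (partial j g) x" for i j
    using assms(1) partial_cong[of x "partial j f" "partial j g" i] by simp
  then show ?thesis using 1[OF assms(1)] by (simp add: L_def)
qed

lemma partial2_add:
  assumes "smooth_on f \<Omega>" "smooth_on g \<Omega>" "x \<in> \<Omega>"
  shows "partial i (partial j (\<lambda>x. f x + g x)) x = partial i (partial j f) x + partial i (partial j g) x"
proof -
  have "partial i (partial j (\<lambda>x. f x + g x)) x = partial i (\<lambda>x. partial j f x + partial j g x) x"
    using assms by (intro partial_cong) (auto simp: partial_add)
  then show ?thesis using assms by (simp add: partial_add)
qed

lemma partial2_mult:
  assumes "smooth_on f \<Omega>" "smooth_on g \<Omega>" "x \<in> \<Omega>"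
  shows "partial i (partial j (\<lambda>x. f x * g x)) x = f x * partial i (partial j g) x
    + partial i f x * partial j g x + partial j f x * partial i g x + partial i (partial j f) x * g x"
proof -
  have "partial i (partial j (\<lambda>x. f x * g x)) x = partial i (\<lambda>x. f x * partial j g x + partial j f x * g x) x"
    using assms by (intro partial_cong) (auto simp: partial_mult)
  then show ?thesis using assms by (simp add: partial_rules)
qed

lemma partial2_exp:
  assumes "smooth_on f \<Omega>" "x \<in> \<Omega>"
  shows "partial i (partial j (\<lambda>x. exp (f x))) x = exp (f x) * (partial i (partial j f) x + partial i f x * partial j f x)"
proof -
  have "partial i (partial j (\<lambda>x. exp (f x))) x = partial i (\<lambda>x. exp (f x) * partial j f x) x"
    using assms by (intro partial_cong) (auto simp: partial_exp)
  then show ?thesis using assms by (simp add: partial_rules algebra_simps)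
qed

lemma L_add: "smooth_on f \<Omega> \<Longrightarrow> smooth_on g \<Omega> \<Longrightarrow> x \<in> \<Omega> \<Longrightarrow> L (\<lambda>x. f x + g x) x = L f x + L g x"
  unfolding L_def by (simp add: partial2_add partial_add algebra_simps)

lemma L_mult: "smooth_on f \<Omega> \<Longrightarrow> smooth_on g \<Omega> \<Longrightarrow> x \<in> \<Omega> \<Longrightarrow>
    L (\<lambda>x. f x * g x) x = f x * L g x + L f x * g x + 2 * \<Gamma> f g x"
  unfolding L_def \<Gamma>_def by (simp add: partial2_mult partial_mult algebra_simps)

lemma L_exp: "smooth_on f \<Omega> \<Longrightarrow> x \<in> \<Omega> \<Longrightarrow> L (\<lambda>x. exp (f x)) x = exp (f x) * (L f x + \<Gamma> f f x)"
  unfolding L_def \<Gamma>_def by (simp add: partial2_exp partial_exp algebra_simps)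

lemma partial2_const [simp]: "partial i (partial j (\<lambda>x. c)) x = 0"
proof -
  have "partial j (\<lambda>x. c) = (\<lambda>x. 0)" by auto
  then show ?thesis by simp
qed

lemma L_const [simp]: "L (\<lambda>x. c) x = 0"
  by (simp add: L_def)

lemma \<Gamma>_const [simp]: "\<Gamma> (\<lambda>x. c) g x = 0" "\<Gamma> g (\<lambda>x. c) x = 0"
  by (simp_all add: \<Gamma>_def)

lemma L_cmult: "smooth_on f \<Omega> \<Longrightarrow> x \<in> \<Omega> \<Longrightarrow> L (\<lambda>x. c * f x) x = c * L f x"
  using L_mult[of "\<lambda>_. c" f] by simp

lemma L_diff: "smooth_on f \<Omega> \<Longrightarrow> smooth_on g \<Omega> \<Longrightarrow> x \<in> \<Omega> \<Longrightarrow> L (\<lambda>x. f x - g x) x = L f x - L g x"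
  using L_add[of f "\<lambda>x. -1 * g x"] L_cmult[of g x "-1"] by simp

lemma L_square: "smooth_on f \<Omega> \<Longrightarrow> x \<in> \<Omega> \<Longrightarrow> L (\<lambda>x. (f x)\<^sup>2) x = 2 * f x * L f x + 2 * \<Gamma> f f x"
  using L_mult[of f f] by (simp add: power2_eq_square)

text \<open>
In the plane $|m|^2 I = m\otimes m + m^\perp\otimes m^\perp$, so $I - m\otimes m$ is the sum of
the two nonnegative forms $\nu^2 I$ and $m^\perp\otimes m^\perp$. The sign arguments below rest on
this decomposition.
\<close>

lemma quadratic_form:
  "(1 - (m 1 x)\<^sup>2) * (p * p') - m 1 x * m 2 x * (p * q' + q * p') + (1 - (m 2 x)\<^sup>2) * (q * q')
    = (\<nu> x)\<^sup>2 * (p * p' + q * q') + (m 1 x * q - m 2 x * p) * (m 1 x * q' - m 2 x * p')"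
  unfolding \<nu>_m by (simp add: algebra_simps power2_eq_square)

lemma \<Gamma>_eq: "\<Gamma> f g x = (\<nu> x)\<^sup>2 * (partial 1 f x * partial 1 g x + partial 2 f x * partial 2 g x)
    + (m 1 x * partial 2 f x - m 2 x * partial 1 f x) * (m 1 x * partial 2 g x - m 2 x * partial 1 g x)"
  unfolding \<Gamma>_def quadratic_form ..

lemma \<Gamma>_nonneg: "\<Gamma> f f x \<ge> 0"
  unfolding \<Gamma>_eq by simp

lemma \<Gamma>_Cauchy_Schwarz: "(\<Gamma> f g x)\<^sup>2 \<le> \<Gamma> f f x * \<Gamma> g g x"
proof (rule quadratic_nonneg_discriminant[OF \<Gamma>_nonneg])
  fix t
  have "0 \<le> (\<nu> x)\<^sup>2 * ((t * partial 1 f x + partial 1 g x)\<^sup>2 + (t * partial 2 f x + partial 2 g x)\<^sup>2)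
    + (m 1 x * (t * partial 2 f x + partial 2 g x) - m 2 x * (t * partial 1 f x + partial 1 g x))\<^sup>2"
    by simp
  also have "\<dots> = \<Gamma> f f x * t\<^sup>2 + 2 * \<Gamma> f g x * t + \<Gamma> g g x"
    unfolding \<Gamma>_eq by algebra
  finally show "0 \<le> \<Gamma> f f x * t\<^sup>2 + 2 * \<Gamma> f g x * t + \<Gamma> g g x" .
qed

lemma \<Gamma>_le_norm: "\<Gamma> f f x \<le> (partial 1 f x)\<^sup>2 + (partial 2 f x)\<^sup>2"
proof -
  have "\<Gamma> f f x = (partial 1 f x)\<^sup>2 + (partial 2 f x)\<^sup>2 - (m 1 x * partial 1 f x + m 2 x * partial 2 f x)\<^sup>2"
    unfolding \<Gamma>_def by algebra
  then show ?thesis by simp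
qed

text \<open>
The first-order part vanishes at a maximum, and the second-order part is a sum of second
derivatives with nonnegative weights by the decomposition of $I - m\otimes m$.
\<close>

lemma interior_maximum_L:
  assumes f: "smooth_on f \<Omega>" and d: "d > 0" "ball x d \<subseteq> \<Omega>"
    and max: "\<And>y. y \<in> ball x d \<Longrightarrow> f y \<le> f x"
  shows "L f x \<le> 0"
proof -
  let ?a = "partial 1 (partial 1 f) x" and ?b = "partial 1 (partial 2 f) x" and ?c = "partial 2 (partial 2 f) x"
  have H: "?a * (v $ 1)\<^sup>2 + 2 * ?b * (v $ 1) * (v $ 2) + ?c * (v $ 2)\<^sup>2 \<le> 0" for v :: "real ^ 2"
    using interior_maximum_hessian[OF f d max] by auto
  have "?a \<le> 0" "?c \<le> 0" "?a * (m 2 x)\<^sup>2 - 2 * ?b * m 1 x * m 2 x + ?c * (m 1 x)\<^sup>2 \<le> 0"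
    using H[of "vector [1, 0]"] H[of "vector [0, 1]"] H[of "vector [- m 2 x, m 1 x]"]
    by (simp_all add: vector_2 algebra_simps)
  moreover have "L f x = (\<nu> x)\<^sup>2 * (?a + ?c) + (?a * (m 2 x)\<^sup>2 - 2 * ?b * m 1 x * m 2 x + ?c * (m 1 x)\<^sup>2)"
    using interior_maximum_gradient[OF f d max, of 2] unfolding L_def \<nu>_m by (simp add: algebra_simps)
  moreover have "(\<nu> x)\<^sup>2 * (?a + ?c) \<le> 0" using \<open>?a \<le> 0\<close> \<open>?c \<le> 0\<close> by (intro mult_nonneg_nonpos) auto
  ultimately show ?thesis by linarith
qed

lemma L_u:
  assumes "x \<in> \<Omega>"
  shows "L u x = 0"
proof -
  have "\<nu> x * L u x = b 1 1 x + b 2 2 x + m 2 x"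
    unfolding L_def b_def w_def h_def using partial_commute_21[OF smooth_u assms]
    by (simp add: m_def[of 2 x] algebra_simps power2_eq_square)
  then show ?thesis using divergence_equation[OF assms] \<nu>_pos[of x] by simp
qed

lemma \<Gamma>_u: "\<Gamma> u g x = (\<nu> x)\<^sup>2 * (partial 1 u x * partial 1 g x + partial 2 u x * partial 2 g x)"
  unfolding \<Gamma>_eq by (simp add: m_def)

lemma \<Gamma>_u_u: "\<Gamma> u u x = 1 - (\<nu> x)\<^sup>2"
  unfolding \<Gamma>_u using \<nu>_m[of x] by (simp add: m_def power2_eq_square algebra_simps)

lemma L_\<nu>:
  assumes "x \<in> \<Omega>"
  shows "L \<nu> x = - S x * \<nu> x"
proof -
  note d = partial_divergence_equation[OF assms, of 1] partial_divergence_equation[OF assms, of 2]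
     divergence_equation[OF assms]
  note d' = d[unfolded jets[OF assms] b_def w_def]
  have *: "partial i (partial j \<nu>) x = \<nu> x * w i x * w j x - \<nu> x * partial i (w j) x" for i j
  proof -
    have "partial i (partial j \<nu>) x = partial i (\<lambda>x. - \<nu> x * w j x) x"
      using assms by (intro partial_cong) (auto simp: partial_\<nu>)
    then show ?thesis using assms by (simp add: partial_rules partial_\<nu>)
  qed
  show ?thesis
    unfolding L_def S_def * partial_\<nu>[OF assms] jets[OF assms] b_def w_def using d' by algebra
qed

text \<open>
The operator has variable coefficients, so differentiating $L f$ leaves the derivative of the
coefficients $-m_k m_l$ as a commutator.
\<close>

lemma L_partial:
  assumes f: "smooth_on f \<Omega>" and x: "x \<in> \<Omega>"
  shows "L (partial j f) x = partial j (L f) x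
    + 2 * (m 1 x * b 1 j x * partial 1 (partial 1 f) x
      + (m 1 x * b 2 j x + m 2 x * b 1 j x) * partial 1 (partial 2 f) x
      + m 2 x * b 2 j x * partial 2 (partial 2 f) x)"
proof -
  have c: "partial k (partial l (partial j f)) x = partial j (partial k (partial l f)) x" for k l
  proof -
    have "partial k (partial l (partial j f)) x = partial k (partial j (partial l f)) x"
      using x partial_commute[OF f] by (intro partial_cong) auto
    then show ?thesis using partial_commute[of "partial l f"] f x by simp
  qed
  have "L f = (\<lambda>x. (1 - (m 1 x)\<^sup>2) * partial 1 (partial 1 f) x
     - 2 * m 1 x * m 2 x * partial 1 (partial 2 f) x
     + (1 - (m 2 x)\<^sup>2) * partial 2 (partial 2 f) x + partial 2 f x)"
    by (simp add: L_def fun_eq_iff)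
  then have "partial j (L f) x = partial j (\<lambda>x. (1 - (m 1 x)\<^sup>2) * partial 1 (partial 1 f) x
     - 2 * m 1 x * m 2 x * partial 1 (partial 2 f) x
     + (1 - (m 2 x)\<^sup>2) * partial 2 (partial 2 f) x + partial 2 f x) x"
    by simp
  also have "\<dots> = (1 - (m 1 x)\<^sup>2) * partial j (partial 1 (partial 1 f)) x
     - 2 * m 1 x * m 2 x * partial j (partial 1 (partial 2 f)) x
     + (1 - (m 2 x)\<^sup>2) * partial j (partial 2 (partial 2 f)) x + partial j (partial 2 f) x
    - 2 * (m 1 x * b 1 j x * partial 1 (partial 1 f) x
      + (m 1 x * b 2 j x + m 2 x * b 1 j x) * partial 1 (partial 2 f) x
      + m 2 x * b 2 j x * partial 2 (partial 2 f) x)"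
    using f x by (simp add: partial_rules partial_m algebra_simps)
  finally show ?thesis
    unfolding L_def c using partial_commute[OF f x, of 2 j] by simp
qed

lemma L_b:
  assumes "x \<in> \<Omega>"
  shows "L (b i j) x = - partial j S x * m i x - S x * b i j x
    + 2 * (m 1 x * b 1 j x * partial 1 (b i 1) x
      + (m 1 x * b 2 j x + m 2 x * b 1 j x) * partial 1 (b i 2) x
      + m 2 x * b 2 j x * partial 2 (b i 2) x)"
proof -
  have "L (b i j) x = L (partial j (m i)) x"
    using assms by (intro L_cong) (auto simp: partial_m)
  moreover have "partial j (L (m i)) x = partial j (\<lambda>x. - S x * m i x) x"
    using assms by (intro partial_cong) (auto simp: L_m)
  ultimately show ?thesis
    using assms by (simp add: L_partial partial_rules partial_m partial2_m)
qed

text \<open>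
For symmetric matrices $X = (p, q; q, r)$ and $X'$ this is the trace of $aXaX'$ with
$a = I - m\otimes m$, the inner product of symmetric bilinear forms in the induced metric. It is
expanded by means of $a = \nu^2 I + m^\perp\otimes m^\perp$, so that it is visibly positive
semidefinite.
\<close>

definition tr :: "real ^ 2 \<Rightarrow> real \<Rightarrow> real \<Rightarrow> real \<Rightarrow> real \<Rightarrow> real \<Rightarrow> real \<Rightarrow> real" where
  "tr x p q r p' q' r' =
    (\<nu> x)^4 * (p * p' + 2 * q * q' + r * r')
    + 2 * (\<nu> x)\<^sup>2 * ((m 1 x * q - m 2 x * p) * (m 1 x * q' - m 2 x * p')
       + (m 1 x * r - m 2 x * q) * (m 1 x * r' - m 2 x * q'))
    + (m 1 x * (m 1 x * r - m 2 x * q) - m 2 x * (m 1 x * q - m 2 x * p))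
     * (m 1 x * (m 1 x * r' - m 2 x * q') - m 2 x * (m 1 x * q' - m 2 x * p'))"

lemma tr_nonneg: "tr x p q r p q r \<ge> 0"
  unfolding tr_def by simp

lemma tr_Cauchy_Schwarz: "(tr x p q r p' q' r')\<^sup>2 \<le> tr x p q r p q r * tr x p' q' r' p' q' r'"
proof (rule quadratic_nonneg_discriminant[OF tr_nonneg])
  fix t
  have "0 \<le> tr x (t * p + p') (t * q + q') (t * r + r') (t * p + p') (t * q + q') (t * r + r')"
    by (rule tr_nonneg)
  also have "\<dots> = tr x p q r p q r * t\<^sup>2 + 2 * tr x p q r p' q' r' * t + tr x p' q' r' p' q' r'"
    unfolding tr_def by algebra
  finally show "0 \<le> tr x p q r p q r * t\<^sup>2 + 2 * tr x p q r p' q' r' * t + tr x p' q' r' p' q' r'" .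
qed

lemma S_eq_tr:
  assumes "x \<in> \<Omega>"
  shows "S x = tr x (h 1 1 x) (h 1 2 x) (h 2 2 x) (h 1 1 x) (h 1 2 x) (h 2 2 x)"
  unfolding S_def tr_def b_def w_def h_commute[OF assms] power4_eq_xxxx using \<nu>_m[of x] by algebra

lemma partial_S:
  assumes "x \<in> \<Omega>"
  shows "partial k S x = 2 * (b 1 1 x * partial k (b 1 1) x + b 1 2 x * partial k (b 2 1) x
     + b 2 1 x * partial k (b 1 2) x + b 2 2 x * partial k (b 2 2) x)"
proof -
  have "partial k S x = partial k (\<lambda>x. (b 1 1 x)\<^sup>2 + 2 * (b 1 2 x * b 2 1 x) + (b 2 2 x)\<^sup>2) x"
    by (simp add: S_def[abs_def])
  then show ?thesis using assms by (simp add: partial_rules)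
qed

lemma partial_S_eq_tr:
  assumes "x \<in> \<Omega>"
  shows "partial 1 S x = 2 * tr x (h 1 1 x) (h 1 2 x) (h 2 2 x) (T 1 1 1 x) (T 1 2 1 x) (T 1 2 2 x)" (is ?A)
    and "partial 2 S x = 2 * tr x (h 1 1 x) (h 1 2 x) (h 2 2 x) (T 1 2 1 x) (T 1 2 2 x) (T 2 2 2 x)" (is ?B)
proof -
  show ?A
    unfolding partial_S[OF assms] tr_def jets[OF assms] b_def w_def power4_eq_xxxx using \<nu>_m[of x] by algebra
  show ?B
    unfolding partial_S[OF assms] tr_def jets[OF assms] b_def w_def power4_eq_xxxx using \<nu>_m[of x] by algebra
qed

text \<open>
Simons' identity for translating graphs: the first summand is twice the squared norm of the
covariant derivative \<open>T\<close>, expanded along the decomposition of $I - m\otimes m$ in its derivative index.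
Applying $L$ to the shape operator only needs the derivative of $L m = -S m$, so no fourth
derivatives of $u$ have to be treated.
\<close>

lemma L_S:
  assumes "x \<in> \<Omega>"
  shows "L S x = 2 * ((\<nu> x)\<^sup>2 *
      (tr x (T 1 1 1 x) (T 1 2 1 x) (T 1 2 2 x) (T 1 1 1 x) (T 1 2 1 x) (T 1 2 2 x)
       + tr x (T 1 2 1 x) (T 1 2 2 x) (T 2 2 2 x) (T 1 2 1 x) (T 1 2 2 x) (T 2 2 2 x))
      + tr x (m 1 x * T 1 2 1 x - m 2 x * T 1 1 1 x) (m 1 x * T 1 2 2 x - m 2 x * T 1 2 1 x)
             (m 1 x * T 2 2 2 x - m 2 x * T 1 2 2 x) (m 1 x * T 1 2 1 x - m 2 x * T 1 1 1 x)
             (m 1 x * T 1 2 2 x - m 2 x * T 1 2 1 x) (m 1 x * T 2 2 2 x - m 2 x * T 1 2 2 x))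
    - 2 * (S x)\<^sup>2"
proof -
  have "L S x = L (\<lambda>x. (b 1 1 x)\<^sup>2 + 2 * (b 1 2 x * b 2 1 x) + (b 2 2 x)\<^sup>2) x"
    by (simp add: S_def[abs_def])
  also have "\<dots> = 2 * (b 1 1 x * L (b 1 1) x + b 1 2 x * L (b 2 1) x + b 2 1 x * L (b 1 2) x + b 2 2 x * L (b 2 2) x)
     + 2 * (\<Gamma> (b 1 1) (b 1 1) x + 2 * \<Gamma> (b 1 2) (b 2 1) x + \<Gamma> (b 2 2) (b 2 2) x)"
    using assms by (simp add: L_add L_square L_cmult L_mult)
  also have "\<dots> = 2 * ((\<nu> x)\<^sup>2 *
      (tr x (T 1 1 1 x) (T 1 2 1 x) (T 1 2 2 x) (T 1 1 1 x) (T 1 2 1 x) (T 1 2 2 x)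
       + tr x (T 1 2 1 x) (T 1 2 2 x) (T 2 2 2 x) (T 1 2 1 x) (T 1 2 2 x) (T 2 2 2 x))
      + tr x (m 1 x * T 1 2 1 x - m 2 x * T 1 1 1 x) (m 1 x * T 1 2 2 x - m 2 x * T 1 2 1 x)
             (m 1 x * T 2 2 2 x - m 2 x * T 1 2 2 x) (m 1 x * T 1 2 1 x - m 2 x * T 1 1 1 x)
             (m 1 x * T 1 2 2 x - m 2 x * T 1 2 1 x) (m 1 x * T 2 2 2 x - m 2 x * T 1 2 2 x))
    - 2 * (S x)\<^sup>2"
    unfolding L_b[OF assms] partial_S[OF assms] \<Gamma>_def S_def tr_def jets[OF assms] b_def w_def power4_eq_xxxx
    using \<nu>_m[of x] by algebra
  finally show ?thesis .
qed

lemma S_nonneg: "x \<in> \<Omega> \<Longrightarrow> S x \<ge> 0"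
  by (simp add: S_eq_tr tr_nonneg)

text \<open>
The gradient of $S = |h|^2$ is $2\langle h, T\rangle$ in each direction, so the Cauchy-Schwarz
inequality bounds $|\nabla S|^2$ by $4 S |T|^2$, and Simons' identity expresses $|T|^2$ by $L S$.
\<close>

lemma \<Gamma>_S_le:
  assumes "x \<in> \<Omega>"
  shows "\<Gamma> S S x \<le> 2 * S x * (L S x + 2 * (S x)\<^sup>2)"
proof -
  let ?h = "tr x (h 1 1 x) (h 1 2 x) (h 2 2 x)"
  let ?t = "\<lambda>p q r. tr x p q r p q r"
  let ?p = "m 1 x * T 1 2 1 x - m 2 x * T 1 1 1 x"
  let ?q = "m 1 x * T 1 2 2 x - m 2 x * T 1 2 1 x"
  let ?r = "m 1 x * T 2 2 2 x - m 2 x * T 1 2 2 x"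
  have C: "(?h p q r)\<^sup>2 \<le> S x * ?t p q r" for p q r
    unfolding S_eq_tr[OF assms] by (rule tr_Cauchy_Schwarz)
  have lin: "m 1 x * partial 2 S x - m 2 x * partial 1 S x = 2 * ?h ?p ?q ?r"
    unfolding partial_S_eq_tr[OF assms] tr_def by algebra
  have "\<Gamma> S S x = 4 * ((\<nu> x)\<^sup>2 * ((?h (T 1 1 1 x) (T 1 2 1 x) (T 1 2 2 x))\<^sup>2
      + (?h (T 1 2 1 x) (T 1 2 2 x) (T 2 2 2 x))\<^sup>2) + (?h ?p ?q ?r)\<^sup>2)"
    unfolding \<Gamma>_eq lin unfolding partial_S_eq_tr[OF assms] by (simp add: power2_eq_square algebra_simps)
  also have "\<dots> \<le> 4 * ((\<nu> x)\<^sup>2 * (S x * ?t (T 1 1 1 x) (T 1 2 1 x) (T 1 2 2 x)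
      + S x * ?t (T 1 2 1 x) (T 1 2 2 x) (T 2 2 2 x)) + S x * ?t ?p ?q ?r)"
    by (intro mult_left_mono add_mono C) auto
  also have "\<dots> = 2 * S x * (L S x + 2 * (S x)\<^sup>2)"
    unfolding L_S[OF assms] by (simp add: algebra_simps)
  finally show ?thesis .
qed

text \<open>
The gradient of \<open>\<nu>\<close> is the shape operator applied to the tangential part of the direction of the
values of $u$, whose squared length is $1-\nu^2$. In coordinates it is the vector inequality \<open>key\<close>,
applied to the rows of $h$ and to its contraction with $m^\perp$.
\<close>

lemma \<Gamma>_\<nu>_le:
  assumes "x \<in> \<Omega>"
  shows "\<Gamma> \<nu> \<nu> x \<le> S x * (1 - (\<nu> x)\<^sup>2)"
proof -
  define c where "c = (\<nu> x)\<^sup>2"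
  have c: "c = 1 - (m 1 x)\<^sup>2 - (m 2 x)\<^sup>2" "c \<ge> 0" by (simp_all add: c_def \<nu>_m[symmetric])
  let ?s = "\<lambda>p q. c * (p * p + q * q) + (m 1 x * q - m 2 x * p)\<^sup>2"
  have key: "c * (p * m 1 x + q * m 2 x)\<^sup>2 \<le> ?s p q * (1 - c)" for p q
  proof -
    have "?s p q * (1 - c) - c * (p * m 1 x + q * m 2 x)\<^sup>2 = (m 1 x * q - m 2 x * p)\<^sup>2"
      unfolding c(1) by algebra
    then show ?thesis by (smt (verit) zero_le_power2)
  qed
  let ?w1 = "w 1 x" and ?w2 = "w 2 x"
  let ?p = "m 1 x * h 1 2 x - m 2 x * h 1 1 x" and ?q = "m 1 x * h 2 2 x - m 2 x * h 1 2 x"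
  have h: "h 2 1 x = h 1 2 x" using assms by (rule h_commute)
  have "\<Gamma> \<nu> \<nu> x = c * (c * (?w1\<^sup>2 + ?w2\<^sup>2) + (m 1 x * ?w2 - m 2 x * ?w1)\<^sup>2)"
    unfolding \<Gamma>_eq partial_\<nu>[OF assms] c_def by algebra
  also have "\<dots> = c * (c * (h 1 1 x * m 1 x + h 1 2 x * m 2 x)\<^sup>2)
    + c * (c * (h 1 2 x * m 1 x + h 2 2 x * m 2 x)\<^sup>2) + c * (?p * m 1 x + ?q * m 2 x)\<^sup>2"
    unfolding w_def h by algebra
  also have "\<dots> \<le> c * (?s (h 1 1 x) (h 1 2 x) * (1 - c)) + c * (?s (h 1 2 x) (h 2 2 x) * (1 - c))
     + ?s ?p ?q * (1 - c)"
    using c(2) by (intro add_mono mult_left_mono key) auto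
  also have "\<dots> = S x * (1 - c)"
    unfolding S_eq_tr[OF assms] tr_def by (simp add: c_def power4_eq_xxxx power2_eq_square) algebra
  finally show ?thesis by (simp add: c_def)
qed

text \<open>
Discarding the nonnegative terms with $m^\perp$ in the squared norm of $h = \nu\operatorname{Hess} u$
leaves $\nu^4$ times its Euclidean norm.
\<close>

lemma norm_Hess_le:
  assumes "x \<in> \<Omega>"
  shows "(norm (Hess u x))\<^sup>2 * (\<nu> x)^6 \<le> S x"
proof -
  have n: "(norm (Hess u x))\<^sup>2 = (partial 1 (partial 1 u) x)\<^sup>2 + 2 * (partial 1 (partial 2 u) x)\<^sup>2 + (partial 2 (partial 2 u) x)\<^sup>2"
    using partial_commute_21[OF smooth_u assms]
    by (simp add: norm_vec_def L2_set_def sum_2 Hess_def)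
  have "(norm (Hess u x))\<^sup>2 * (\<nu> x)^6 = (\<nu> x)^4 * (h 1 1 x * h 1 1 x + 2 * h 1 2 x * h 1 2 x + h 2 2 x * h 2 2 x)"
    unfolding n h_def by algebra
  then show ?thesis
    unfolding S_eq_tr[OF assms] tr_def by simp
qed

end

section \<open>Parabolic boxes and their cutoff functions\<close>

text \<open>
The asymmetry in the second coordinate reflects the direction of time: information travels
downwards, so the box needs the long side $R^2$ only above its centre.
\<close>

definition parabolic_box :: "real ^ 2 \<Rightarrow> real \<Rightarrow> (real ^ 2) set" where
  "parabolic_box p R = {x. \<bar>x $ 1 - p $ 1\<bar> \<le> R \<and> - R \<le> x $ 2 - p $ 2 \<and> x $ 2 - p $ 2 \<le> R\<^sup>2}"

text \<open>
The cutoff is to be nonpositive on the boundary of the box with $L\varphi \ge -C/R^2$ inside, so it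
may grow rapidly upwards but may decrease upwards at most at rate $1/R^2$. The linear term removes
the upper side. The exponential removes the lower side within the short distance $R$; its
derivative, of order $1/R$, has the favourable sign. The coefficient 5 makes the exponential exceed
$2 + 2/R \le 18$ on the lower side when $R \ge 1/8$, and the coefficient 18 does the same on the
lateral sides.
\<close>

definition cutoff :: "real ^ 2 \<Rightarrow> real \<Rightarrow> real ^ 2 \<Rightarrow> real" where
  "cutoff p R x = 2 - 18 / R\<^sup>2 * (x $ 1 - p $ 1)\<^sup>2 - 2 / R\<^sup>2 * (x $ 2 - p $ 2) - exp (- 5 / R * (x $ 2 - p $ 2))"

definition cutoff_const :: real where
  "cutoff_const = 36\<^sup>2 + (16 + 5 * exp 5)\<^sup>2"

lemma compact_parabolic_box: "compact (parabolic_box p R)"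
proof -
  have "parabolic_box p R = cbox (vector [p $ 1 - R, p $ 2 - R]) (vector [p $ 1 + R, p $ 2 + R\<^sup>2])"
    by (auto simp: parabolic_box_def mem_box_cart forall_2 vector_2 abs_le_iff)
  then show ?thesis by simp
qed

lemma cutoff_center: "cutoff p R p = 1"
  by (simp add: cutoff_def)

lemma cutoff_const_ge: "cutoff_const \<ge> 18" "cutoff_const \<ge> 36 + 2 + 25 * exp 5"
proof -
  have "(5 * exp 5)\<^sup>2 \<ge> 25 * exp (5 :: real)" by (simp add: power2_eq_square)
  moreover have "(16 + 5 * exp 5)\<^sup>2 \<ge> (5 * exp (5::real))\<^sup>2" by (intro power_mono) auto
  ultimately show "cutoff_const \<ge> 36 + 2 + 25 * exp 5" by (simp add: cutoff_const_def)
  moreover have "exp (5::real) > 0" by simp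
  ultimately show "cutoff_const \<ge> 18" by linarith
qed

lemma exp_5_ge: "exp (5 :: real) \<ge> 18"
proof -
  have "exp (1 :: real) \<ge> 2" using exp_ge_add_one_self[of 1] by simp
  then have "exp (1 :: real) ^ 5 \<ge> 2 ^ 5" by (intro power_mono) auto
  then show ?thesis by (simp flip: exp_of_nat_mult)
qed

context
  fixes p :: "real ^ 2" and R :: real and x :: "real ^ 2"
  assumes R: "R \<ge> 1 / 8" and x: "x \<in> parabolic_box p R"
begin

lemma cutoff_le: "cutoff p R x \<le> 18 - 18 / R\<^sup>2 * (x $ 1 - p $ 1)\<^sup>2"
    "cutoff p R x \<le> 18 - exp (- 5 / R * (x $ 2 - p $ 2))"
proof -
  have "2 / R\<^sup>2 * (x $ 2 - p $ 2) \<ge> 2 / R\<^sup>2 * (- R)"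
    using x R by (intro mult_left_mono) (auto simp: parabolic_box_def)
  moreover have "2 / R\<^sup>2 * (- R) \<ge> - 16" using R by (simp add: power2_eq_square field_simps)
  moreover have "18 / R\<^sup>2 * (x $ 1 - p $ 1)\<^sup>2 \<ge> 0" by simp
  moreover have "exp (- 5 / R * (x $ 2 - p $ 2)) > 0" by simp
  ultimately show "cutoff p R x \<le> 18 - 18 / R\<^sup>2 * (x $ 1 - p $ 1)\<^sup>2"
    "cutoff p R x \<le> 18 - exp (- 5 / R * (x $ 2 - p $ 2))" unfolding cutoff_def by linarith+
qed

lemma cutoff_le_const: "cutoff p R x \<le> cutoff_const"
proof -
  have "exp (- 5 / R * (x $ 2 - p $ 2)) > 0" by simp
  then show ?thesis using cutoff_le(2) cutoff_const_ge(1) by linarith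
qed

lemma cutoff_pos_interior:
  assumes pos: "cutoff p R x > 0"
  shows "\<bar>x $ 1 - p $ 1\<bar> < R" "- R < x $ 2 - p $ 2" "x $ 2 - p $ 2 < R\<^sup>2"
proof -
  have "18 / R\<^sup>2 * (x $ 1 - p $ 1)\<^sup>2 < 18" using cutoff_le(1) pos by linarith
  then have "(x $ 1 - p $ 1)\<^sup>2 < R\<^sup>2" using R by (simp add: field_simps)
  then show "\<bar>x $ 1 - p $ 1\<bar> < R" using power2_less_imp_less[of "\<bar>x $ 1 - p $ 1\<bar>" R] R by simp
  have e: "exp (- 5 / R * (x $ 2 - p $ 2)) < 18" using cutoff_le(2) pos by linarith
  have "x $ 2 - p $ 2 \<noteq> - R"
  proof
    assume "x $ 2 - p $ 2 = - R"
    then have "exp (- 5 / R * (x $ 2 - p $ 2)) = exp 5" using R by simp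
    then show False using e exp_5_ge by linarith
  qed
  then show "- R < x $ 2 - p $ 2" using x by (auto simp: parabolic_box_def)
  have "x $ 2 - p $ 2 \<noteq> R\<^sup>2"
  proof
    assume "x $ 2 - p $ 2 = R\<^sup>2"
    then have "2 / R\<^sup>2 * (x $ 2 - p $ 2) = 2" using R by simp
    moreover have "18 / R\<^sup>2 * (x $ 1 - p $ 1)\<^sup>2 \<ge> 0" by simp
    moreover have "exp (- 5 / R * (x $ 2 - p $ 2)) > 0" by simp
    ultimately show False using pos unfolding cutoff_def by linarith
  qed
  then show "x $ 2 - p $ 2 < R\<^sup>2" using x by (auto simp: parabolic_box_def)
qed

lemma cutoff_exp_le: "exp (- 5 / R * (x $ 2 - p $ 2)) \<le> exp 5"
proof -
  have "- 5 / R * (x $ 2 - p $ 2) \<le> 5" using x R by (simp add: parabolic_box_def field_simps)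
  then show ?thesis by simp
qed

end

text \<open>
The cutoff is nonpositive on the boundary of the box, so a maximum of a localised quantity at a
point with positive cutoff is an interior maximum.
\<close>

lemma cutoff_pos_neighbourhood:
  assumes "R \<ge> 1 / 8" "x \<in> parabolic_box p R" "cutoff p R x > 0"
  obtains d where "d > 0" "ball x d \<subseteq> parabolic_box p R" "\<And>y. y \<in> ball x d \<Longrightarrow> cutoff p R y \<ge> 0"
proof -
  let ?U = "{y. \<bar>y $ 1 - p $ 1\<bar> < R} \<inter> {y. - R < y $ 2 - p $ 2} \<inter> {y. y $ 2 - p $ 2 < R\<^sup>2} \<inter> {y. 0 < cutoff p R y}"
  have "open ?U"
    unfolding cutoff_def
    by (intro open_Int open_Collect_less continuous_intros)
  moreover have "x \<in> ?U" using cutoff_pos_interior[OF assms] assms(3) by simp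
  ultimately obtain d where "d > 0" "ball x d \<subseteq> ?U" using openE by blast
  then show ?thesis by (intro that[of d]) (auto simp: parabolic_box_def subset_iff less_imp_le)
qed

section \<open>Gradient bound at a fixed scale\<close>

text \<open>
The constants come from the proof below with $\beta = 1/(4(M+1))$, $C = 13/(r^2\beta^2)$ and
$\nu_0 = \beta r/16$; the value is $\nu_0 e^{-C}$.
\<close>

definition gradient_bound :: "real \<Rightarrow> real \<Rightarrow> real" where
  "gradient_bound r M = r / (64 * (M + 1)) * exp (- 208 * (M + 1)\<^sup>2 / r\<^sup>2)"

context soliton
begin

lemma L_component [simp]: "L (\<lambda>x. x $ 1) x = 0" "L (\<lambda>x. x $ 2) x = 1"
proof -
  have "partial j (\<lambda>x. x $ i) = (\<lambda>x. if j = i then 1 else 0)" for i j by (rule ext) simp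
  then show "L (\<lambda>x. x $ 1) x = 0" "L (\<lambda>x. x $ 2) x = 1" by (simp_all add: L_def)
qed

lemma \<Gamma>_cmult:
  assumes "smooth_on f \<Omega>" "x \<in> \<Omega>"
  shows "\<Gamma> (\<lambda>x. c * f x) g x = c * \<Gamma> f g x" "\<Gamma> g (\<lambda>x. c * f x) x = c * \<Gamma> g f x"
  using assms unfolding \<Gamma>_def by (simp_all add: partial_rules algebra_simps)

lemma partial_shift: "x \<in> \<Omega> \<Longrightarrow> partial i (\<lambda>x. x $ j - a) x = (if i = j then 1 else 0)"
  by (simp add: partial_diff)

lemma L_shift_square:
  assumes "x \<in> \<Omega>"
  shows "L (\<lambda>x. (x $ 1 - a)\<^sup>2) x = 2 * (1 - (m 1 x)\<^sup>2)"
    and "L (\<lambda>x. (x $ 2 - a)\<^sup>2) x = 2 * (x $ 2 - a) + 2 * (1 - (m 2 x)\<^sup>2)"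
  using assms by (simp_all add: L_square L_diff \<Gamma>_def partial_shift)

text \<open>
Let $\varphi = 1/2 - |x-p|^2/r^2 + \beta(u - u(p))$. The size of $\beta$ makes the oscillation of
$\beta u$ at most $1/2$, so $\varphi \le 0$ on the bounding circle, while $\varphi(p) > 0$. At a
maximum of $(e^{C\varphi}-1)/\nu$ with value $Q$, the function $e^{C\varphi} - Q\nu$ has an interior maximum
and $-Q L\nu = QS\nu \ge 0$, so $L e^{C\varphi} \le 0$ there. Where the graph is steep, however,
$|\nabla\varphi|_a^2$ is at least $\beta^2/2$, because $|\nabla u|_a^2 = 1-\nu^2$ is close to one;
for large $C$ the second-order term of the exponential then wins. Hence the graph is not steep at
the maximum, and comparing the values of the quotient there and at $p$ bounds $1/\nu(p)$.
\<close>

lemma interior_gradient_estimate: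
  assumes r: "0 < r" "r \<le> 1" and ball: "cball p r \<subseteq> \<Omega>"
    and M: "\<And>x. x \<in> cball p r \<Longrightarrow> \<bar>u x\<bar> \<le> M"
  shows "gradient_bound r M \<le> \<nu> p"
proof -
  have "\<bar>u p\<bar> \<le> M" using M[of p] r by simp
  then have M0: "M \<ge> 0" by simp
  define \<beta> where "\<beta> = 1 / (4 * (M + 1))"
  have \<beta>: "0 < \<beta>" "\<beta> \<le> 1 / 4" using M0 by (auto simp: \<beta>_def field_simps)
  define C where "C = 13 / (r\<^sup>2 * \<beta>\<^sup>2)"
  have "r\<^sup>2 * \<beta>\<^sup>2 \<le> 1 * 1" using r \<beta> by (intro mult_mono power_le_one) auto
  then have C: "C \<ge> 13" using r \<beta> by (simp add: C_def field_simps)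
  define \<nu>0 where "\<nu>0 = \<beta> * r / 16"
  have "\<beta> * r \<le> 1 / 4 * 1" using r \<beta> by (intro mult_mono) auto
  then have \<nu>0: "0 < \<nu>0" "\<nu>0 \<le> 1 / 64" using r \<beta> by (auto simp: \<nu>0_def)
  define \<kappa> where "\<kappa> = - (1 / r\<^sup>2)"
  define \<psi> where "\<psi> x = \<kappa> * ((x $ 1 - p $ 1)\<^sup>2 + (x $ 2 - p $ 2)\<^sup>2)" for x :: "real ^ 2"
  define \<phi> where "\<phi> x = \<psi> x + (\<beta> * u x + (1 / 2 - \<beta> * u p))" for x :: "real ^ 2"
  have smooth_\<psi>: "smooth_on \<psi> \<Omega>" unfolding \<psi>_def[abs_def]
    by (intro smooth_on_mult smooth_on_const smooth_on_add smooth_on_power smooth_on_diff smooth_on_component)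
  have smooth_\<phi>: "smooth_on \<phi> \<Omega>" unfolding \<phi>_def[abs_def] using smooth_\<psi> by simp
  have dist2: "(x $ 1 - p $ 1)\<^sup>2 + (x $ 2 - p $ 2)\<^sup>2 = (dist p x)\<^sup>2" for x :: "real ^ 2"
    by (simp add: dist_norm norm_vec_def L2_set_def sum_2 power2_commute[of "p $ 1"] power2_commute[of "p $ 2"])
  have osc: "\<bar>\<beta> * (u x - u p)\<bar> \<le> 1 / 2" if "x \<in> cball p r" for x
  proof -
    have "\<bar>u x - u p\<bar> \<le> 2 * (M + 1)" using M[of x] M[of p] that r by auto
    then have "\<beta> * \<bar>u x - u p\<bar> \<le> \<beta> * (2 * (M + 1))" using \<beta> by (intro mult_left_mono) auto
    also have "\<dots> = 1 / 2" using M0 by (simp add: \<beta>_def field_simps)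
    finally show ?thesis using \<beta> by (simp add: abs_mult)
  qed
  have \<phi>_eq: "\<phi> x = \<psi> x + \<beta> * (u x - u p) + 1 / 2" for x
    by (simp add: \<phi>_def algebra_simps)
  have \<psi>_le: "\<psi> x \<le> 0" for x using r by (simp add: \<psi>_def \<kappa>_def dist2)
  have \<phi>_le: "\<phi> x \<le> 1" if "x \<in> cball p r" for x
    using osc[OF that] \<psi>_le[of x] unfolding \<phi>_eq abs_le_iff by linarith
  have "\<psi> x = - 1" if "dist p x = r" for x using that r by (simp add: \<psi>_def \<kappa>_def dist2)
  then have \<phi>_sphere: "\<phi> x \<le> 0" if "dist p x = r" for x
    using osc[of x] that unfolding \<phi>_eq abs_le_iff by simp
  have \<phi>_p: "\<phi> p = 1 / 2" by (simp add: \<phi>_def \<psi>_def)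
  have "continuous_on (cball p r) (\<lambda>x. (exp (C * \<phi> x) - 1) / \<nu> x)"
    by (intro continuous_intros continuous_on_subset[OF smooth_on_continuous_on ball] smooth_\<phi> smooth_\<nu>)
       (use \<nu>_pos in \<open>auto simp: less_imp_neq[symmetric]\<close>)
  then obtain z where z: "z \<in> cball p r"
    and zmax: "\<And>y. y \<in> cball p r \<Longrightarrow> (exp (C * \<phi> y) - 1) / \<nu> y \<le> (exp (C * \<phi> z) - 1) / \<nu> z"
    using continuous_attains_sup[of "cball p r" "\<lambda>x. (exp (C * \<phi> x) - 1) / \<nu> x"] r by auto
  define Q where "Q = (exp (C * \<phi> z) - 1) / \<nu> z"
  have "exp (C / 2) - 1 \<ge> 1" using exp_ge_add_one_self[of "C / 2"] C by linarith
  then have "1 / \<nu> p \<le> (exp (C * \<phi> p) - 1) / \<nu> p"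
    using \<nu>_pos[of p] by (intro divide_right_mono) (auto simp: \<phi>_p)
  also have "\<dots> \<le> Q" using zmax[of p] r by (simp add: Q_def)
  finally have Q: "1 / \<nu> p \<le> Q" .
  then have Q_pos: "Q > 0" using \<nu>_pos[of p] by (smt (verit) divide_pos_pos)
  then have "exp (C * \<phi> z) > 1" using \<nu>_pos[of z] by (simp add: Q_def zero_less_divide_iff)
  then have "\<phi> z > 0" using C by (simp add: zero_less_mult_iff)
  then have z': "z \<in> ball p r" using z \<phi>_sphere[of z] by (cases "dist p z = r") auto
  then have zO: "z \<in> \<Omega>" using ball by auto
  obtain d where d: "d > 0" "ball z d \<subseteq> ball p r" using openE[OF open_ball z'] by blast
  have "\<nu>0 < \<nu> z"
  proof (rule ccontr)
    assume "\<not> \<nu>0 < \<nu> z"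
    then have \<nu>z: "\<nu> z \<le> \<nu>0" by simp
    \<comment> \<open>Multiplying the quotient out gives a function whose maximum needs no quotient rule.\<close>
    let ?F = "\<lambda>x. exp (C * \<phi> x) - Q * \<nu> x"
    have smooth_F: "smooth_on ?F \<Omega>" using smooth_\<phi> by simp
    have "L ?F z \<le> 0"
    proof (rule interior_maximum_L[OF smooth_F d(1)])
      show "ball z d \<subseteq> \<Omega>" using d(2) ball ball_subset_cball[of p r] by (meson order_trans)
      fix y assume "y \<in> ball z d"
      then have "y \<in> cball p r" using d ball_subset_cball by blast
      then have "(exp (C * \<phi> y) - 1) / \<nu> y \<le> Q" using zmax by (simp add: Q_def)
      then show "?F y \<le> ?F z" using \<nu>_pos[of y] \<nu>_pos[of z] by (simp add: Q_def pos_divide_le_eq)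
    qed
    moreover have "L ?F z = exp (C * \<phi> z) * (C * L \<phi> z + C * (C * \<Gamma> \<phi> \<phi> z)) + Q * S z * \<nu> z"
      using smooth_\<phi> zO
      by (simp add: L_diff L_exp L_cmult L_\<nu> \<Gamma>_cmult)
    moreover have "Q * S z * \<nu> z \<ge> 0" using Q_pos S_nonneg[OF zO] \<nu>_pos[of z] by simp
    ultimately have "exp (C * \<phi> z) * (C * (L \<phi> z + C * \<Gamma> \<phi> \<phi> z)) \<le> 0" by (simp add: distrib_left)
    then have le0: "L \<phi> z + C * \<Gamma> \<phi> \<phi> z \<le> 0" using C by (simp add: mult_le_0_iff)
    have L\<phi>: "L \<phi> z \<ge> - 6 / r\<^sup>2"
    proof -
      have "\<bar>z $ 2 - p $ 2\<bar> \<le> r"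
        using component_le_norm_cart[of "z - p" 2] z by (simp add: dist_norm norm_minus_commute)
      then have "2 * (z $ 2 - p $ 2) \<le> 2" using r by simp
      moreover have "2 * (1 - (m 1 z)\<^sup>2) \<le> 2" "2 * (1 - (m 2 z)\<^sup>2) \<le> 2" by simp_all
      ultimately have "2 * (1 - (m 1 z)\<^sup>2) + (2 * (z $ 2 - p $ 2) + 2 * (1 - (m 2 z)\<^sup>2)) \<le> 2 + (2 + 2)"
        by (intro add_mono)
      then have "(1 / r\<^sup>2) * (2 * (1 - (m 1 z)\<^sup>2) + (2 * (z $ 2 - p $ 2) + 2 * (1 - (m 2 z)\<^sup>2))) \<le> (1 / r\<^sup>2) * (2 + (2 + 2))"
        by (intro mult_left_mono) auto
      moreover have "L \<phi> z = \<kappa> * (2 * (1 - (m 1 z)\<^sup>2) + (2 * (z $ 2 - p $ 2) + 2 * (1 - (m 2 z)\<^sup>2)))"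
        unfolding \<phi>_def[abs_def] \<psi>_def using zO
        by (simp add: L_add L_cmult L_shift_square L_u)
      ultimately show ?thesis by (simp add: \<kappa>_def)
    qed
    have \<Gamma>\<phi>: "\<Gamma> \<phi> \<phi> z \<ge> \<beta>\<^sup>2 / 2"
    proof -
      have p\<psi>: "partial i \<psi> z = 2 * \<kappa> * (z $ i - p $ i)" for i
        unfolding \<psi>_def[abs_def] using zO exhaust_2[of i]
        by (auto simp: partial_rules partial_shift)
      have "\<Gamma> \<phi> \<phi> z = \<Gamma> \<psi> \<psi> z + 2 * \<beta> * \<Gamma> u \<psi> z + \<beta>\<^sup>2 * \<Gamma> u u z"
      proof -
        have "partial i \<phi> z = partial i \<psi> z + \<beta> * partial i u z" for i
          unfolding \<phi>_def[abs_def] using smooth_\<psi> zO by (simp add: partial_rules)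
        then show ?thesis unfolding \<Gamma>_def by (simp add: algebra_simps power2_eq_square)
      qed
      moreover have "\<bar>\<Gamma> u \<psi> z\<bar> \<le> 2 * \<nu> z / r"
      proof -
        have "(m 1 z * (z $ 1 - p $ 1) + m 2 z * (z $ 2 - p $ 2))\<^sup>2
            \<le> ((m 1 z)\<^sup>2 + (m 2 z)\<^sup>2) * ((z $ 1 - p $ 1)\<^sup>2 + (z $ 2 - p $ 2)\<^sup>2)"
        proof -
          have "((m 1 z)\<^sup>2 + (m 2 z)\<^sup>2) * ((z $ 1 - p $ 1)\<^sup>2 + (z $ 2 - p $ 2)\<^sup>2)
            - (m 1 z * (z $ 1 - p $ 1) + m 2 z * (z $ 2 - p $ 2))\<^sup>2
            = (m 1 z * (z $ 2 - p $ 2) - m 2 z * (z $ 1 - p $ 1))\<^sup>2" by algebra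
          then show ?thesis by (smt (verit) zero_le_power2)
        qed
        also have "\<dots> \<le> 1 * r\<^sup>2"
        proof (rule mult_mono)
          show "(m 1 z)\<^sup>2 + (m 2 z)\<^sup>2 \<le> 1" using \<nu>_m[of z] zero_le_power2[of "\<nu> z"] by linarith
          show "(z $ 1 - p $ 1)\<^sup>2 + (z $ 2 - p $ 2)\<^sup>2 \<le> r\<^sup>2"
            unfolding dist2 using z by (intro power_mono) auto
        qed auto
        finally have "\<bar>m 1 z * (z $ 1 - p $ 1) + m 2 z * (z $ 2 - p $ 2)\<bar> \<le> r"
          using r by (simp add: abs_le_square_iff[symmetric] flip: abs_of_pos)
        then have "(2 * \<nu> z / r\<^sup>2) * \<bar>m 1 z * (z $ 1 - p $ 1) + m 2 z * (z $ 2 - p $ 2)\<bar> \<le> (2 * \<nu> z / r\<^sup>2) * r"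
          using \<nu>_pos[of z] by (intro mult_left_mono) auto
        moreover have "\<Gamma> u \<psi> z = 2 * \<nu> z * \<kappa> * (m 1 z * (z $ 1 - p $ 1) + m 2 z * (z $ 2 - p $ 2))"
          unfolding \<Gamma>_u p\<psi> m_def by (simp add: power2_eq_square algebra_simps)
        moreover have "2 * \<nu> z * \<kappa> = - (2 * \<nu> z / r\<^sup>2)" by (simp add: \<kappa>_def)
        ultimately show ?thesis using r \<nu>_pos[of z] by (simp add: abs_mult power2_eq_square)
      qed
      then have "2 * \<beta> * \<Gamma> u \<psi> z \<ge> - (\<beta>\<^sup>2 / 4)"
      proof -
        assume *: "\<bar>\<Gamma> u \<psi> z\<bar> \<le> 2 * \<nu> z / r"
        have "2 * \<nu> z / r \<le> 2 * \<nu>0 / r" using \<nu>z r by (intro divide_right_mono) auto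
        also have "\<dots> = \<beta> / 8" using r by (simp add: \<nu>0_def)
        finally have "- (\<beta> / 8) \<le> \<Gamma> u \<psi> z" using * by linarith
        from mult_left_mono[OF this, of "2 * \<beta>"] show ?thesis using \<beta> by (simp add: power2_eq_square)
      qed
      moreover have "\<beta>\<^sup>2 * \<Gamma> u u z \<ge> \<beta>\<^sup>2 * (3 / 4)"
      proof -
        have "(\<nu> z)\<^sup>2 \<le> (1 / 2)\<^sup>2" using \<nu>z \<nu>0 \<nu>_pos[of z] by (intro power_mono) auto
        then show ?thesis unfolding \<Gamma>_u_u by (intro mult_left_mono) (auto simp: power2_eq_square)
      qed
      ultimately show ?thesis using \<Gamma>_nonneg[of \<psi> z] by linarith
    qed
    have "C * (\<beta>\<^sup>2 / 2) \<le> C * \<Gamma> \<phi> \<phi> z" using \<Gamma>\<phi> C by (intro mult_left_mono) auto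
    moreover have "C * (\<beta>\<^sup>2 / 2) = 13 / 2 / r\<^sup>2" using \<beta> by (simp add: C_def)
    moreover have "6 / r\<^sup>2 < 13 / 2 / r\<^sup>2" using r by (intro divide_strict_right_mono) auto
    ultimately show False using le0 L\<phi> by simp
  qed
  have "1 / \<nu> p \<le> (exp (C * \<phi> z) - 1) / \<nu> z" using Q by (simp add: Q_def)
  also have "\<dots> \<le> exp (C * \<phi> z) / \<nu> z" using \<nu>_pos[of z] by (intro divide_right_mono) auto
  also have "\<dots> \<le> exp C / \<nu>0"
    using \<phi>_le[OF z] C \<nu>0 \<open>\<nu>0 < \<nu> z\<close> by (intro frac_le) auto
  finally have "\<nu>0 * exp (- C) \<le> \<nu> p"
    using \<nu>0 \<nu>_pos[of p] by (simp add: exp_minus field_simps)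
  moreover have "\<nu>0 * exp (- C) = gradient_bound r M"
    using M0 r by (simp add: \<nu>0_def C_def gradient_bound_def \<beta>_def power2_eq_square field_simps)
  ultimately show ?thesis by simp
qed

lemma smooth_cutoff [intro!, simp]: "smooth_on (cutoff p R) \<Omega>"
  unfolding cutoff_def[abs_def]
  by (intro smooth_on_diff smooth_on_mult smooth_on_const smooth_on_power smooth_on_component smooth_on_exp)

context
  fixes p :: "real ^ 2" and R :: real and x :: "real ^ 2"
  assumes R: "R \<ge> 1 / 8" and x: "x \<in> parabolic_box p R"
begin

lemma partial_cutoff:
  assumes "x \<in> \<Omega>"
  shows "partial 1 (cutoff p R) x = - (36 / R\<^sup>2 * (x $ 1 - p $ 1))"
    and "partial 2 (cutoff p R) x = 5 / R * exp (- 5 / R * (x $ 2 - p $ 2)) - 2 / R\<^sup>2"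
proof -
  define a c e where "a = 18 / R\<^sup>2" and "c = 2 / R\<^sup>2" and "e = - 5 / R"
  have eq: "cutoff p R = (\<lambda>x. 2 - a * (x $ 1 - p $ 1)\<^sup>2 - c * (x $ 2 - p $ 2) - exp (e * (x $ 2 - p $ 2)))"
    by (simp add: cutoff_def fun_eq_iff a_def c_def e_def)
  show "partial 1 (cutoff p R) x = - (36 / R\<^sup>2 * (x $ 1 - p $ 1))"
    unfolding eq using assms by (simp add: partial_rules) (simp add: a_def)
  show "partial 2 (cutoff p R) x = 5 / R * exp (- 5 / R * (x $ 2 - p $ 2)) - 2 / R\<^sup>2"
    unfolding eq using assms by (simp add: partial_rules) (simp add: c_def e_def)
qed

lemma \<Gamma>_cutoff:
  assumes "x \<in> \<Omega>"
  shows "\<Gamma> (cutoff p R) (cutoff p R) x \<le> cutoff_const / R\<^sup>2"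
proof -
  let ?e = "exp (- 5 / R * (x $ 2 - p $ 2))"
  note p = partial_cutoff[OF assms]
  have "36 / R\<^sup>2 * \<bar>x $ 1 - p $ 1\<bar> \<le> 36 / R\<^sup>2 * R"
    using x by (intro mult_left_mono) (auto simp: parabolic_box_def)
  also have "\<dots> = 36 / R" using R by (simp add: power2_eq_square)
  finally have 1: "\<bar>partial 1 (cutoff p R) x\<bar> \<le> 36 / R"
    unfolding p abs_minus_cancel abs_mult by simp
  have "\<bar>partial 2 (cutoff p R) x\<bar> \<le> \<bar>5 / R * ?e\<bar> + \<bar>2 / R\<^sup>2\<bar>"
    unfolding p by (rule abs_triangle_ineq4)
  also have "\<dots> = 5 / R * ?e + 2 / R\<^sup>2" using R by simp
  also have "\<dots> \<le> 5 / R * exp 5 + 16 / R"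
  proof (rule add_mono)
    show "2 / R\<^sup>2 \<le> 16 / R" using R by (simp add: power2_eq_square field_simps)
    show "5 / R * ?e \<le> 5 / R * exp 5" using R cutoff_exp_le[OF R x] by (intro mult_left_mono) auto
  qed
  also have "\<dots> = (16 + 5 * exp 5) / R" by (simp add: add_divide_distrib)
  finally have 2: "\<bar>partial 2 (cutoff p R) x\<bar> \<le> (16 + 5 * exp 5) / R" .
  have "\<Gamma> (cutoff p R) (cutoff p R) x \<le> \<bar>partial 1 (cutoff p R) x\<bar>\<^sup>2 + \<bar>partial 2 (cutoff p R) x\<bar>\<^sup>2"
    using \<Gamma>_le_norm by simp
  also have "\<dots> \<le> (36 / R)\<^sup>2 + ((16 + 5 * exp 5) / R)\<^sup>2"
    by (intro add_mono power_mono 1 2) auto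
  also have "\<dots> = cutoff_const / R\<^sup>2"
    unfolding cutoff_const_def power_divide add_divide_distrib[symmetric] ..
  finally show ?thesis .
qed

lemma L_cutoff:
  assumes "x \<in> \<Omega>"
  shows "L (cutoff p R) x \<ge> - (cutoff_const / R\<^sup>2)"
proof -
  let ?e = "exp (- 5 / R * (x $ 2 - p $ 2))"
  define a c e where "a = 18 / R\<^sup>2" and "c = 2 / R\<^sup>2" and "e = - 5 / R"
  have eq: "cutoff p R = (\<lambda>x. 2 - a * (x $ 1 - p $ 1)\<^sup>2 - c * (x $ 2 - p $ 2) - exp (e * (x $ 2 - p $ 2)))"
    by (simp add: cutoff_def fun_eq_iff a_def c_def e_def)
  have \<Gamma>_e: "\<Gamma> (\<lambda>x. e * (x $ 2 - p $ 2)) (\<lambda>x. e * (x $ 2 - p $ 2)) x = e\<^sup>2 * (1 - (m 2 x)\<^sup>2)"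
    using assms by (simp add: \<Gamma>_def partial_rules power2_eq_square)
  have "L (cutoff p R) x = - (a * (2 * (1 - (m 1 x)\<^sup>2))) - c - exp (e * (x $ 2 - p $ 2)) * (e + e\<^sup>2 * (1 - (m 2 x)\<^sup>2))"
    unfolding eq using assms
    by (simp add: L_diff L_cmult L_shift_square L_exp \<Gamma>_e)
  moreover have "a * (2 * (1 - (m 1 x)\<^sup>2)) \<le> a * 2"
    unfolding a_def by (intro mult_left_mono) auto
  moreover have "?e * e \<le> 0" using R by (simp add: e_def)
  moreover have "(m 2 x)\<^sup>2 \<le> 1"
    using \<nu>_m[of x] zero_le_power2[of "\<nu> x"] zero_le_power2[of "m 1 x"] by linarith
  then have "?e * (e\<^sup>2 * (1 - (m 2 x)\<^sup>2)) \<le> exp 5 * (e\<^sup>2 * 1)"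
    by (intro mult_mono mult_left_mono cutoff_exp_le[OF R x] mult_nonneg_nonneg) auto
  moreover have "?e = exp (e * (x $ 2 - p $ 2))" by (simp add: e_def)
  ultimately have "L (cutoff p R) x \<ge> - (a * 2) - c - exp 5 * e\<^sup>2"
    by (simp add: distrib_left)
  also have "- (a * 2) - c - exp 5 * e\<^sup>2 = - ((36 + 2 + 25 * exp 5) / R\<^sup>2)"
    by (simp add: a_def c_def e_def power_divide add_divide_distrib)
  finally have "L (cutoff p R) x \<ge> - ((36 + 2 + 25 * exp 5) / R\<^sup>2)" .
  moreover have "(36 + 2 + 25 * exp 5) / R\<^sup>2 \<le> cutoff_const / R\<^sup>2"
    using cutoff_const_ge(2) by (intro divide_right_mono) auto
  ultimately show ?thesis by linarith
qed

end

end

section \<open>Decay of the gradient and of the curvature\<close>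

lemma abs_le_add_of_square_le:
  fixes x y z :: real
  assumes "0 \<le> x" "0 \<le> y" "z\<^sup>2 \<le> 4 * (x * y)"
  shows "\<bar>z\<bar> \<le> x + y"
proof -
  have "(x + y)\<^sup>2 = (x - y)\<^sup>2 + 4 * (x * y)" by algebra
  then have "z\<^sup>2 \<le> (x + y)\<^sup>2" using assms(3) zero_le_power2[of "x - y"] by linarith
  then show ?thesis using assms by (metis abs_le_square_iff abs_of_nonneg add_nonneg_nonneg)
qed

definition decay_const :: "real \<Rightarrow> real" where
  "decay_const c = cutoff_const\<^sup>2 + 4 * cutoff_const / c + 1"

lemma decay_const_pos: "c > 0 \<Longrightarrow> decay_const c > 0"
  using cutoff_const_ge(1) by (simp add: decay_const_def add_nonneg_pos)

definition curvature_const :: "real \<Rightarrow> real \<Rightarrow> real" where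
  "curvature_const k N = cutoff_const * (4 + 2 * cutoff_const + 8 * N / k) / k * N\<^sup>2"

context soliton
begin

text \<open>
At an interior maximum of $\varphi^2(1-\nu) + \mu u^2$ the only harmful term without a factor
$1-\nu$ is the cross term $4\varphi\,\Gamma(\varphi,\nu)$. Since $|\nabla\nu|_a^2 \le S(1-\nu^2)$, it is
absorbed by $L(1-\nu) = S\nu$ up to a multiple of $1-\nu$. Choosing $\mu$ as a large multiple of
$1/R^2$ makes $L$ of the quantity positive unless the first summand vanishes, so the maximum is at
most $\mu M^2$.
\<close>

lemma interior_gradient_decay:
  assumes R: "R \<ge> 1 / 8" and box: "parabolic_box p R \<subseteq> \<Omega>"
    and M: "\<And>x. x \<in> parabolic_box p R \<Longrightarrow> \<bar>u x\<bar> \<le> M"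
    and c: "c > 0" "\<And>x. x \<in> parabolic_box p R \<Longrightarrow> c \<le> \<nu> x"
  shows "1 - \<nu> p \<le> decay_const c * M\<^sup>2 / R\<^sup>2"
proof -
  let ?\<phi> = "cutoff p R" and ?C = cutoff_const
  define \<mu> where "\<mu> = decay_const c / R\<^sup>2"
  define G where "G = ?C / R\<^sup>2"
  have G: "G > 0" using cutoff_const_ge(1) R by (simp add: G_def)
  have \<mu>: "\<mu> > 0" using decay_const_pos[OF c(1)] R by (simp add: \<mu>_def)
  let ?Q = "\<lambda>x. (?\<phi> x)\<^sup>2 * (1 - \<nu> x) + \<mu> * (u x)\<^sup>2"
  have smooth_Q: "smooth_on ?Q \<Omega>" by simp
  \<comment> \<open>The region where the cutoff is negative is excluded, since its square is positive there.\<close>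
  define K where "K = parabolic_box p R \<inter> {x. 0 \<le> ?\<phi> x}"
  have "closed {x. 0 \<le> ?\<phi> x}"
    unfolding cutoff_def by (intro closed_Collect_le continuous_intros)
  then have "compact K" unfolding K_def by (intro compact_Int_closed compact_parabolic_box)
  moreover have pK: "p \<in> K" using R by (simp add: K_def cutoff_center parabolic_box_def)
  moreover have "continuous_on K ?Q"
    using smooth_on_continuous_on[OF smooth_Q] by (rule continuous_on_subset) (use box in \<open>auto simp: K_def\<close>)
  ultimately obtain z where z: "z \<in> K" and zmax: "\<And>y. y \<in> K \<Longrightarrow> ?Q y \<le> ?Q z"
    using continuous_attains_sup[of K ?Q] by blast
  have zB: "z \<in> parabolic_box p R" and zO: "z \<in> \<Omega>" and \<phi>z: "?\<phi> z \<ge> 0" using z box by (auto simp: K_def)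
  have zero: "(?\<phi> z)\<^sup>2 * (1 - \<nu> z) = 0"
  proof (rule ccontr)
    assume ne: "(?\<phi> z)\<^sup>2 * (1 - \<nu> z) \<noteq> 0"
    then have \<phi>_pos: "?\<phi> z > 0" and \<nu>1: "\<nu> z < 1" using \<phi>z \<nu>_le_1[of z] by (auto simp: less_le)
    obtain d where d: "d > 0" "ball z d \<subseteq> parabolic_box p R" "\<And>y. y \<in> ball z d \<Longrightarrow> ?\<phi> y \<ge> 0"
      using cutoff_pos_neighbourhood[OF R zB \<phi>_pos] by metis
    have le: "L ?Q z \<le> 0"
      by (rule interior_maximum_L[OF smooth_Q d(1)]) (use d box zmax in \<open>auto simp: K_def\<close>)
    let ?v = "\<nu> z" and ?s = "S z" and ?f = "?\<phi> z"
    have c\<nu>: "c \<le> ?v" using c(2)[OF zB] .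
    have s: "?s \<ge> 0" using S_nonneg[OF zO] .
    have \<Gamma>1: "\<Gamma> (\<lambda>x. (?\<phi> x)\<^sup>2) (\<lambda>x. 1 - \<nu> x) z = - 2 * ?f * \<Gamma> ?\<phi> \<nu> z"
      unfolding \<Gamma>_def using zO by (simp add: partial_rules algebra_simps)
    have LQ: "L ?Q z = ?f\<^sup>2 * (?s * ?v) + (1 - ?v) * (2 * ?f * L ?\<phi> z + 2 * \<Gamma> ?\<phi> ?\<phi> z)
        - 4 * ?f * \<Gamma> ?\<phi> \<nu> z + \<mu> * (2 * (1 - ?v\<^sup>2))"
      using zO by (simp add: L_add L_mult L_diff L_cmult L_square L_\<nu> L_u \<Gamma>_u_u \<Gamma>1)
    have w: "1 - ?v\<^sup>2 = (1 - ?v) * (1 + ?v)" by algebra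
    have "\<bar>4 * ?f * \<Gamma> ?\<phi> \<nu> z\<bar> \<le> ?f\<^sup>2 * (?s * ?v) + 4 * G * (1 - ?v\<^sup>2) / ?v"
    proof (rule abs_le_add_of_square_le)
      show "0 \<le> ?f\<^sup>2 * (?s * ?v)" using s \<nu>_pos[of z] by simp
      show "0 \<le> 4 * G * (1 - ?v\<^sup>2) / ?v" unfolding w using G \<nu>_pos[of z] \<nu>_le_1[of z] by simp
      have "(\<Gamma> ?\<phi> \<nu> z)\<^sup>2 \<le> \<Gamma> ?\<phi> ?\<phi> z * \<Gamma> \<nu> \<nu> z" by (rule \<Gamma>_Cauchy_Schwarz)
      also have "\<dots> \<le> G * (?s * (1 - ?v\<^sup>2))"
        unfolding G_def using \<Gamma>_cutoff[OF R zB zO] \<Gamma>_\<nu>_le[OF zO] \<Gamma>_nonneg cutoff_const_ge(1)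
        by (intro mult_mono) auto
      finally have "16 * ?f\<^sup>2 * (\<Gamma> ?\<phi> \<nu> z)\<^sup>2 \<le> 16 * ?f\<^sup>2 * (G * (?s * (1 - ?v\<^sup>2)))"
        by (intro mult_left_mono) auto
      also have "\<dots> = 4 * (?f\<^sup>2 * (?s * ?v) * (4 * G * (1 - ?v\<^sup>2) / ?v))" using \<nu>_pos[of z] by simp
      finally show "(4 * ?f * \<Gamma> ?\<phi> \<nu> z)\<^sup>2 \<le> 4 * (?f\<^sup>2 * (?s * ?v) * (4 * G * (1 - ?v\<^sup>2) / ?v))"
        by (simp add: power_mult_distrib)
    qed
    moreover have "4 * G * (1 - ?v\<^sup>2) / ?v \<le> (1 - ?v) * (8 * G / c)"
    proof -
      have "(1 + ?v) / ?v \<le> 2 / c" using c c\<nu> \<nu>_le_1[of z] by (intro frac_le) auto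
      then have "4 * G * (1 - ?v) * ((1 + ?v) / ?v) \<le> 4 * G * (1 - ?v) * (2 / c)"
        using G \<nu>1 by (intro mult_left_mono) auto
      moreover have "4 * G * (1 - ?v\<^sup>2) / ?v = 4 * G * (1 - ?v) * ((1 + ?v) / ?v)"
        unfolding w by simp
      moreover have "4 * G * (1 - ?v) * (2 / c) = (1 - ?v) * (8 * G / c)" by simp
      ultimately show ?thesis by argo
    qed
    moreover have "2 * ?f * L ?\<phi> z + 2 * \<Gamma> ?\<phi> ?\<phi> z \<ge> - (2 * ?C * G)"
    proof -
      have "?f * (- L ?\<phi> z) \<le> ?f * G"
        using L_cutoff[OF R zB zO] \<phi>z by (intro mult_left_mono) (auto simp: G_def)
      also have "\<dots> \<le> ?C * G" using cutoff_le_const[OF R zB] G by (intro mult_right_mono) auto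
      finally show ?thesis using \<Gamma>_nonneg[of ?\<phi> z] by simp
    qed
    then have "(1 - ?v) * (2 * ?f * L ?\<phi> z + 2 * \<Gamma> ?\<phi> ?\<phi> z) \<ge> (1 - ?v) * (- (2 * ?C * G))"
      using \<nu>1 by (intro mult_left_mono) auto
    moreover have "\<mu> * (2 * (1 - ?v\<^sup>2)) \<ge> (1 - ?v) * (2 * \<mu>)"
    proof -
      have "(2 * \<mu> * (1 - ?v)) * (1 + ?v) \<ge> (2 * \<mu> * (1 - ?v)) * 1"
        using \<mu> \<nu>1 \<nu>_pos[of z] by (intro mult_left_mono) auto
      then show ?thesis unfolding w by (simp add: algebra_simps)
    qed
    ultimately have "(1 - ?v) * (2 * \<mu>) - (1 - ?v) * (2 * ?C * G) - (1 - ?v) * (8 * G / c) \<le> 0"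
      using le unfolding LQ by (simp only: mult_minus_right)
    then have "(1 - ?v) * (2 * \<mu> - 2 * ?C * G - 8 * G / c) \<le> 0" by (simp add: algebra_simps)
    moreover have "2 * \<mu> - 2 * ?C * G - 8 * G / c = 2 / R\<^sup>2"
      unfolding \<mu>_def G_def decay_const_def using R c(1)
      by (simp add: add_divide_distrib power2_eq_square algebra_simps)
    moreover have "(1 - ?v) * (2 / R\<^sup>2) > 0" using \<nu>1 R by (intro mult_pos_pos) auto
    ultimately show False by (metis not_le)
  qed
  have "1 - \<nu> p \<le> (1 - \<nu> p) + \<mu> * (u p)\<^sup>2" using \<mu> by simp
  also have "\<dots> \<le> \<mu> * (u z)\<^sup>2" using zmax[OF pK] unfolding zero cutoff_center by simp
  also have "\<dots> \<le> \<mu> * M\<^sup>2" using \<mu> M[OF zB] by (intro mult_left_mono) (auto simp: abs_le_square_iff[symmetric])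
  finally show ?thesis by (simp add: \<mu>_def)
qed

text \<open>
Let $h = \nu - k$, so that $L h = -S(h+k)$. At an interior maximum of $\varphi^2 S/h^2$ the terms
$\pm 2S^2$ from $L S$ and $L h$ cancel and $2kS^2/h$ remains. The squared gradients of $S$ and $h$ cancel
as well, because $\nabla S/S = 2\nabla h/h - 2\nabla\varphi/\varphi$ at the maximum. What is left is
an upper bound for $k\varphi^2 S/h$ by terms of order $1/R^2$, where the cross term is controlled by
$(1-\nu^2)/h \le 2N$. As $h$ lies between $\epsilon$ and $N\epsilon$, this bounds $S(p)$ by a
multiple of $\epsilon/R^2$; a small $\epsilon$ is what turns the scale-invariant bound into decay.
\<close>

lemma interior_curvature_estimate:
  assumes R: "R \<ge> 1 / 8" and box: "parabolic_box p R \<subseteq> \<Omega>"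
    and k: "k0 > 0" "k \<ge> k0" and \<epsilon>: "\<epsilon> > 0"
    and low: "\<And>x. x \<in> parabolic_box p R \<Longrightarrow> \<epsilon> \<le> \<nu> x - k"
    and high: "\<And>x. x \<in> parabolic_box p R \<Longrightarrow> \<nu> x - k \<le> N * \<epsilon>"
    and grad: "\<And>x. x \<in> parabolic_box p R \<Longrightarrow> 1 - \<nu> x \<le> N * \<epsilon>"
  shows "S p \<le> curvature_const k0 N * \<epsilon> / R\<^sup>2"
proof -
  let ?\<phi> = "cutoff p R" and ?C = cutoff_const
  define G where "G = ?C / R\<^sup>2"
  have G: "G > 0" using cutoff_const_ge(1) R by (simp add: G_def)
  define E where "E = G * (4 + 2 * ?C + 8 * N / k0) / k0"
  have pB: "p \<in> parabolic_box p R" using R by (simp add: parabolic_box_def)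
  have "0 < N * \<epsilon>" using low[OF pB] high[OF pB] \<epsilon> by linarith
  then have N: "N > 0" using \<epsilon> by (simp add: zero_less_mult_iff)
  let ?q = "\<lambda>x. (?\<phi> x)\<^sup>2 * S x / (\<nu> x - k)\<^sup>2"
  define K where "K = parabolic_box p R \<inter> {x. 0 \<le> ?\<phi> x}"
  have "closed {x. 0 \<le> ?\<phi> x}"
    unfolding cutoff_def by (intro closed_Collect_le continuous_intros)
  then have "compact K" unfolding K_def by (intro compact_Int_closed compact_parabolic_box)
  moreover have pK: "p \<in> K" using pB by (simp add: K_def cutoff_center)
  moreover have "continuous_on K ?q"
  proof -
    have "K \<subseteq> \<Omega>" using box by (auto simp: K_def)
    moreover have "\<nu> x - k \<noteq> 0" if "x \<in> K" for x using low[of x] that \<epsilon> by (auto simp: K_def)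
    ultimately show ?thesis
      by (intro continuous_intros continuous_on_subset[OF smooth_on_continuous_on]) auto
  qed
  ultimately obtain z where z: "z \<in> K" and zmax: "\<And>y. y \<in> K \<Longrightarrow> ?q y \<le> ?q z"
    using continuous_attains_sup[of K ?q] by blast
  have zB: "z \<in> parabolic_box p R" and zO: "z \<in> \<Omega>" and \<phi>z: "?\<phi> z \<ge> 0" using z box by (auto simp: K_def)
  define H where "H = \<nu> z - k"
  have H: "\<epsilon> \<le> H" "0 < H" using low[OF zB] \<epsilon> by (auto simp: H_def)
  have main: "(?\<phi> z)\<^sup>2 * S z / H \<le> E"
  proof (cases "(?\<phi> z)\<^sup>2 * S z = 0")
    case True
    have "E \<ge> 0" using G k N cutoff_const_ge(1) by (simp add: E_def)
    then show ?thesis unfolding True by simp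
  next
    case False
    then have \<phi>_pos: "?\<phi> z > 0" and s: "S z > 0" using \<phi>z S_nonneg[OF zO] by (auto simp: less_le)
    obtain d where d: "d > 0" "ball z d \<subseteq> parabolic_box p R" "\<And>y. y \<in> ball z d \<Longrightarrow> ?\<phi> y \<ge> 0"
      using cutoff_pos_neighbourhood[OF R zB \<phi>_pos] by metis
    let ?v = "\<nu> z" and ?s = "S z" and ?f = "?\<phi> z"
    define Q where "Q = ?f\<^sup>2 * ?s / H\<^sup>2"
    \<comment> \<open>As before, the maximality of the quotient is expressed without division.\<close>
    let ?F = "\<lambda>x. (?\<phi> x)\<^sup>2 * S x - Q * (\<nu> x - k)\<^sup>2"
    have smooth_F: "smooth_on ?F \<Omega>" by simp
    have dO: "ball z d \<subseteq> \<Omega>" using d(2) box by auto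
    have Fmax: "?F y \<le> ?F z" if "y \<in> ball z d" for y
    proof -
      have yB: "y \<in> parabolic_box p R" and yK: "y \<in> K" using that d by (auto simp: K_def)
      have "(?\<phi> y)\<^sup>2 * S y / (\<nu> y - k)\<^sup>2 \<le> Q" using zmax[OF yK] by (simp add: Q_def H_def)
      moreover have "\<nu> y - k > 0" using low[OF yB] \<epsilon> by simp
      moreover have "?F z = 0" using H by (simp add: Q_def flip: H_def)
      ultimately show ?thesis by (simp add: pos_divide_le_eq)
    qed
    have L: "L ?F z \<le> 0" using interior_maximum_L[OF smooth_F d(1) dO Fmax] .
    have "partial i ?F z = 0" for i using interior_maximum_gradient[OF smooth_F d(1) dO Fmax] .
    then have grad0: "?f\<^sup>2 * partial i S z + 2 * ?f * partial i ?\<phi> z * ?s = 2 * Q * H * partial i \<nu> z" for i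
      using zO by (simp add: partial_rules H_def algebra_simps)
    \<comment> \<open>The critical point equation eliminates the gradient of the curvature.\<close>
    have pS: "partial i S z = 2 * ?s * (partial i \<nu> z / H - partial i ?\<phi> z / ?f)" for i
    proof -
      have "2 * Q * H * partial i \<nu> z = ?f\<^sup>2 * (2 * ?s * (partial i \<nu> z / H))"
        using H by (simp add: Q_def power2_eq_square)
      moreover have "2 * ?f * partial i ?\<phi> z * ?s = ?f\<^sup>2 * (2 * ?s * (partial i ?\<phi> z / ?f))"
        using \<phi>_pos by (simp add: power2_eq_square)
      ultimately have "?f\<^sup>2 * partial i S z = ?f\<^sup>2 * (2 * ?s * (partial i \<nu> z / H - partial i ?\<phi> z / ?f))"
        using grad0[of i] by (simp add: right_diff_distrib)
      then show ?thesis using \<phi>_pos by simp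
    qed
    have ne: "H \<noteq> 0" "?f \<noteq> 0" using H \<phi>_pos by auto
    define A B D where "A = \<Gamma> ?\<phi> ?\<phi> z" and "B = \<Gamma> ?\<phi> \<nu> z" and "D = \<Gamma> \<nu> \<nu> z"
    have \<Gamma>SS: "\<Gamma> S S z = 4 * ?s\<^sup>2 * (D / H\<^sup>2 - 2 * B / (H * ?f) + A / ?f\<^sup>2)"
      unfolding \<Gamma>_def pS A_def B_def D_def
      by (simp add: ne power2_eq_square divide_simps) algebra
    have \<Gamma>\<phi>S: "\<Gamma> ?\<phi> S z = 2 * ?s * (B / H - A / ?f)"
      unfolding \<Gamma>_def pS A_def B_def by (simp add: divide_inverse algebra_simps)
    have LS: "L S z \<ge> 2 * ?s * (D / H\<^sup>2 - 2 * B / (H * ?f) + A / ?f\<^sup>2) - 2 * ?s\<^sup>2"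
    proof -
      have "2 * ?s * (2 * ?s * (D / H\<^sup>2 - 2 * B / (H * ?f) + A / ?f\<^sup>2)) \<le> 2 * ?s * (L S z + 2 * ?s\<^sup>2)"
        using \<Gamma>_S_le[OF zO] unfolding \<Gamma>SS by (simp add: power2_eq_square algebra_simps)
      then have "2 * ?s * (D / H\<^sup>2 - 2 * B / (H * ?f) + A / ?f\<^sup>2) \<le> L S z + 2 * ?s\<^sup>2"
        using s by (simp add: mult_le_cancel_left)
      then show ?thesis by simp
    qed
    have \<Gamma>1: "\<Gamma> (\<lambda>x. (?\<phi> x)\<^sup>2) S z = 2 * ?f * \<Gamma> ?\<phi> S z"
      unfolding \<Gamma>_def using zO by (simp add: partial_rules algebra_simps)
    have \<Gamma>2: "\<Gamma> (\<lambda>x. \<nu> x - k) (\<lambda>x. \<nu> x - k) z = D"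
      unfolding \<Gamma>_def D_def using zO by (simp add: partial_rules)
    have LF: "L ?F z = ?f\<^sup>2 * L S z + (2 * ?f * L ?\<phi> z + 2 * A) * ?s + 4 * ?f * \<Gamma> ?\<phi> S z
        - Q * (2 * H * (- ?s * ?v) + 2 * D)"
      using zO by (simp add: L_mult L_diff L_cmult L_square L_\<nu> \<Gamma>1 \<Gamma>2 A_def H_def)
    have "0 \<ge> ?f\<^sup>2 * (2 * ?s * (D / H\<^sup>2 - 2 * B / (H * ?f) + A / ?f\<^sup>2) - 2 * ?s\<^sup>2)
       + (2 * ?f * L ?\<phi> z + 2 * A) * ?s + 4 * ?f * (2 * ?s * (B / H - A / ?f))
        - Q * (2 * H * (- ?s * ?v) + 2 * D)"
      using L mult_left_mono[OF LS, of "?f\<^sup>2"] unfolding LF \<Gamma>\<phi>S by simp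
    also have "?f\<^sup>2 * (2 * ?s * (D / H\<^sup>2 - 2 * B / (H * ?f) + A / ?f\<^sup>2) - 2 * ?s\<^sup>2)
       + (2 * ?f * L ?\<phi> z + 2 * A) * ?s + 4 * ?f * (2 * ?s * (B / H - A / ?f))
        - Q * (2 * H * (- ?s * ?v) + 2 * D)
      = ?s * (2 * k * (?f\<^sup>2 * ?s / H) + 2 * ?f * L ?\<phi> z - 4 * A + 4 * ?f * B / H)"
    proof -
      have v: "?v = H + k" by (simp add: H_def)
      show ?thesis unfolding Q_def v by (simp add: ne divide_simps power2_eq_square) algebra
    qed
    finally have "2 * k * (?f\<^sup>2 * ?s / H) + 2 * ?f * L ?\<phi> z - 4 * A + 4 * ?f * B / H \<le> 0"
      using s by (simp add: mult_le_0_iff)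
    moreover define X Y where "X = ?f\<^sup>2 * ?s / H" and "Y = 4 * ?f * B / H"
    ultimately have key: "2 * (k * X) + 2 * (?f * L ?\<phi> z) - 4 * A + Y \<le> 0" by (simp only: mult.assoc)
    have X: "X \<ge> 0" using s H by (simp add: X_def)
    have "\<bar>Y\<bar> \<le> k0 * X + 8 * G * N / k0"
      unfolding X_def Y_def
    proof (rule abs_le_add_of_square_le)
      show "0 \<le> k0 * (?f\<^sup>2 * ?s / H)" "0 \<le> 8 * G * N / k0" using k s H G N by auto
      have "1 - ?v\<^sup>2 = (1 - ?v) * (1 + ?v)" by algebra
      also have "\<dots> \<le> (1 - ?v) * 2" using \<nu>_le_1[of z] by (intro mult_left_mono) auto
      also have "\<dots> \<le> N * H * 2"
        using order_trans[OF grad[OF zB] mult_left_mono[OF H(1), of N]] N by (intro mult_right_mono) auto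
      finally have v: "1 - ?v\<^sup>2 \<le> N * H * 2" .
      have "B\<^sup>2 \<le> A * D" unfolding A_def B_def D_def by (rule \<Gamma>_Cauchy_Schwarz)
      also have "\<dots> \<le> G * (?s * (1 - ?v\<^sup>2))"
        unfolding A_def D_def G_def using \<Gamma>_cutoff[OF R zB zO] \<Gamma>_\<nu>_le[OF zO] \<Gamma>_nonneg cutoff_const_ge(1)
        by (intro mult_mono) auto
      also have "\<dots> \<le> G * (?s * (N * H * 2))" using G s v by (intro mult_left_mono) auto
      finally have "16 * ?f\<^sup>2 / H\<^sup>2 * B\<^sup>2 \<le> 16 * ?f\<^sup>2 / H\<^sup>2 * (G * (?s * (N * H * 2)))"
        by (intro mult_left_mono) auto
      also have "\<dots> = 4 * (k0 * (?f\<^sup>2 * ?s / H) * (8 * G * N / k0))"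
        using H k by (simp add: power2_eq_square)
      finally show "(4 * ?f * B / H)\<^sup>2 \<le> 4 * (k0 * (?f\<^sup>2 * ?s / H) * (8 * G * N / k0))"
        by (simp add: power_mult_distrib power_divide)
    qed
    moreover have "- (?f * L ?\<phi> z) \<le> ?C * G"
    proof -
      have "?f * (- L ?\<phi> z) \<le> ?f * G"
        using L_cutoff[OF R zB zO] \<phi>z by (intro mult_left_mono) (auto simp: G_def)
      also have "\<dots> \<le> ?C * G" using cutoff_le_const[OF R zB] G by (intro mult_right_mono) auto
      finally show ?thesis by simp
    qed
    moreover have "A \<le> G" unfolding A_def G_def using \<Gamma>_cutoff[OF R zB zO] .
    moreover have "k0 * X \<le> k * X" using k X by (intro mult_right_mono) auto
    ultimately have "k0 * X \<le> 4 * G + 2 * (?C * G) + 8 * G * N / k0"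
      using key by linarith
    also have "\<dots> = k0 * E" using k by (simp add: E_def field_simps)
    finally have "X \<le> E" using k by simp
    then show ?thesis by (simp add: X_def)
  qed
  define h0 where "h0 = \<nu> p - k"
  have h0: "0 < h0" "h0 \<le> N * \<epsilon>" using low[OF pB] high[OF pB] \<epsilon> by (auto simp: h0_def)
  have "S p / h0\<^sup>2 \<le> (?\<phi> z)\<^sup>2 * S z / H\<^sup>2"
    using zmax[OF pK] by (simp add: cutoff_center H_def h0_def)
  also have "\<dots> = ((?\<phi> z)\<^sup>2 * S z / H) / H" by (simp add: power2_eq_square)
  also have "\<dots> \<le> E / H" using main H by (intro divide_right_mono) auto
  also have "\<dots> \<le> E / \<epsilon>"
    using H \<epsilon> G k N cutoff_const_ge(1) by (intro divide_left_mono) (auto simp: E_def)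
  finally have "S p \<le> E / \<epsilon> * h0\<^sup>2" using h0 by (simp add: pos_divide_le_eq)
  also have "\<dots> \<le> E / \<epsilon> * (N * \<epsilon>)\<^sup>2"
    using h0 \<epsilon> G k N cutoff_const_ge(1) by (intro mult_left_mono power_mono) (auto simp: E_def)
  also have "\<dots> = curvature_const k0 N * \<epsilon> / R\<^sup>2"
    using \<epsilon> by (simp add: E_def G_def curvature_const_def power2_eq_square mult_ac)
  finally show ?thesis .
qed

end

section \<open>The Hessian estimate at scale R\<close>

definition hessian_const :: "real \<Rightarrow> real" where
  "hessian_const M =
    (let c = gradient_bound (1 / 64) M; D = 16 * decay_const c * (M\<^sup>2 + 1)
     in sqrt (4 * curvature_const (c / 2) (1 + 2 / c) * D / c ^ 6) + 1)"

lemma gradient_bound_bounds: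
  assumes "M \<ge> 0"
  shows "0 < gradient_bound (1 / 64) M" "gradient_bound (1 / 64) M < 1"
proof -
  have "exp (- 208 * (M + 1)\<^sup>2 / (1 / 64)\<^sup>2) \<le> (1 :: real)" by simp
  then have "1 / 64 / (64 * (M + 1)) * exp (- 208 * (M + 1)\<^sup>2 / (1 / 64)\<^sup>2) \<le> 1 / 64 / (64 * (M + 1)) * 1"
    using assms by (intro mult_left_mono) auto
  also have "\<dots> < 1" using assms by (simp add: field_simps)
  finally show "gradient_bound (1 / 64) M < 1" by (simp add: gradient_bound_def)
  show "0 < gradient_bound (1 / 64) M" using assms by (simp add: gradient_bound_def)
qed

lemma curvature_const_nonneg: "k > 0 \<Longrightarrow> N > 0 \<Longrightarrow> curvature_const k N \<ge> 0"
  unfolding curvature_const_def using cutoff_const_ge(1) by simp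

lemma hessian_const_pos:
  assumes "M \<ge> 0"
  shows "hessian_const M > 0"
proof -
  let ?c = "gradient_bound (1 / 64) M"
  have c: "?c > 0" by (rule gradient_bound_bounds[OF assms])
  then have "1 + 2 / ?c > 0" by (simp add: add_pos_pos)
  then have "curvature_const (?c / 2) (1 + 2 / ?c) \<ge> 0" "decay_const ?c > 0"
    using c curvature_const_nonneg decay_const_pos by simp_all
  then show ?thesis unfolding hessian_const_def Let_def using c
    by (intro add_nonneg_pos) (auto intro!: divide_nonneg_pos mult_nonneg_nonneg)
qed

lemma parabolic_box_halve:
  assumes "q \<in> parabolic_box p (R / 2)" "R \<ge> 0"
  shows "parabolic_box q (R / 2) \<subseteq> parabolic_box p R"
proof
  fix x assume x: "x \<in> parabolic_box q (R / 2)"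
  have "(R / 2)\<^sup>2 + (R / 2)\<^sup>2 \<le> R\<^sup>2" by (simp add: power2_eq_square)
  then show "x \<in> parabolic_box p R"
    using assms x unfolding parabolic_box_def mem_Collect_eq abs_le_iff by auto
qed

lemma cball_subset_parabolic_box:
  assumes "R \<ge> 1 / 8"
  shows "cball p (1 / 64) \<subseteq> parabolic_box p R"
proof
  fix x assume "x \<in> cball p (1 / 64)"
  then have "\<bar>x $ i - p $ i\<bar> \<le> 1 / 64" for i
    using component_le_norm_cart[of "x - p" i] by (simp add: dist_norm norm_minus_commute)
  from this[of 1] this[of 2] have "\<bar>x $ 1 - p $ 1\<bar> \<le> 1 / 64" "\<bar>x $ 2 - p $ 2\<bar> \<le> 1 / 64" by auto
  moreover have "(1 / 8)\<^sup>2 \<le> R\<^sup>2" using assms by (intro power_mono) auto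
  then have "1 / 64 \<le> R\<^sup>2" by (simp add: power2_eq_square)
  ultimately show "x \<in> parabolic_box p R"
    using assms unfolding parabolic_box_def mem_Collect_eq abs_le_iff by auto
qed

context soliton
begin

text \<open>
The three estimates are applied on nested boxes. The numbers $\delta$, a bound for $1-\nu$,
and $\epsilon = c\delta/2$ are of order at most $1/R^2$, and the truncation at $1-c$ keeps
$k = 1-\delta-\epsilon$ above $c/2$ even when $R$ is too small for $D/R^2$ to be below one.
\<close>

lemma hessian_estimate:
  assumes R: "R \<ge> 1 / 2" and box: "parabolic_box p R \<subseteq> \<Omega>"
    and M: "\<And>x. x \<in> \<Omega> \<Longrightarrow> \<bar>u x\<bar> \<le> M"
  shows "norm (Hess u p) \<le> hessian_const M / R\<^sup>2"
proof -
  have pB: "p \<in> parabolic_box p r" if "r \<ge> 0" for p r using that by (simp add: parabolic_box_def)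
  have pO: "p \<in> \<Omega>" using pB[of R p] box R by auto
  have M0: "M \<ge> 0" using M[OF pO] by linarith
  define c where "c = gradient_bound (1 / 64) M"
  have c: "0 < c" "c < 1" using gradient_bound_bounds[OF M0] by (auto simp: c_def)
  have \<nu>_ge: "c \<le> \<nu> q" if "parabolic_box q r \<subseteq> \<Omega>" "r \<ge> 1 / 8" for q r
  proof -
    have sub: "cball q (1 / 64) \<subseteq> \<Omega>" using that cball_subset_parabolic_box[of r q] by blast
    show ?thesis
      unfolding c_def by (rule interior_gradient_estimate[OF _ _ sub]) (use M sub in \<open>auto simp: subset_iff\<close>)
  qed
  define D where "D = 16 * decay_const c * (M\<^sup>2 + 1)"
  have D: "D > 0" using decay_const_pos[OF c(1)] by (simp add: D_def add_nonneg_pos)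
  have grad: "1 - \<nu> q \<le> D / R\<^sup>2" if q: "parabolic_box q (R / 2) \<subseteq> \<Omega>" for q
  proof -
    have sub: "parabolic_box z (R / 4) \<subseteq> \<Omega>" if "z \<in> parabolic_box q (R / 4)" for z
      using parabolic_box_halve[of z q "R / 2"] that q R by simp
    have sub': "parabolic_box q (R / 4) \<subseteq> \<Omega>" using sub[OF pB] R by simp
    have "c \<le> \<nu> z" if "z \<in> parabolic_box q (R / 4)" for z
      using \<nu>_ge[OF sub[OF that]] R by simp
    then have "1 - \<nu> q \<le> decay_const c * M\<^sup>2 / (R / 4)\<^sup>2"
      by (intro interior_gradient_decay sub' M c(1)) (use R sub' in auto)
    also have "\<dots> = 16 * decay_const c * M\<^sup>2 / R\<^sup>2" by (simp add: power_divide)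
    also have "\<dots> \<le> D / R\<^sup>2"
      unfolding D_def using decay_const_pos[OF c(1)] by (intro divide_right_mono mult_left_mono) auto
    finally show ?thesis .
  qed
  define \<delta> where "\<delta> = min (1 - c) (D / R\<^sup>2)"
  define \<epsilon> where "\<epsilon> = c * \<delta> / 2"
  define k where "k = 1 - \<delta> - \<epsilon>"
  define N where "N = 1 + 2 / c"
  have \<delta>: "\<delta> > 0" "\<delta> \<le> 1 - c" "\<delta> \<le> D / R\<^sup>2" using c D R by (auto simp: \<delta>_def)
  have \<epsilon>: "\<epsilon> > 0" using c \<delta> by (simp add: \<epsilon>_def)
  have N\<epsilon>: "N * \<epsilon> = \<epsilon> + \<delta>" using c by (simp add: N_def \<epsilon>_def algebra_simps)
  have "c * \<delta> \<le> c * 1" using c \<delta> by (intro mult_left_mono) auto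
  then have k: "k \<ge> c / 2" using \<delta> by (simp add: k_def \<epsilon>_def)
  have "c * \<delta> \<le> 1 * \<delta>" using c \<delta> by (intro mult_right_mono) auto
  then have "\<epsilon> \<le> \<delta>" using \<delta>(1) by (simp add: \<epsilon>_def)
  then have \<epsilon>_le: "\<epsilon> \<le> D / R\<^sup>2" using \<delta>(3) by linarith
  have N: "N > 0" using c by (simp add: N_def add_pos_pos)
  have near: "1 - \<nu> q \<le> \<delta>" if "q \<in> parabolic_box p (R / 2)" for q
  proof -
    have q: "parabolic_box q (R / 2) \<subseteq> \<Omega>" using parabolic_box_halve[OF that] R box by auto
    show ?thesis using grad[OF q] \<nu>_ge[OF q] R by (simp add: \<delta>_def)
  qed
  have "S p \<le> curvature_const (c / 2) N * \<epsilon> / (R / 2)\<^sup>2"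
  proof (rule interior_curvature_estimate[where k = k])
    show "parabolic_box p (R / 2) \<subseteq> \<Omega>" using parabolic_box_halve[of p p R] pB R box by auto
  next
    fix q assume q: "q \<in> parabolic_box p (R / 2)"
    show "\<epsilon> \<le> \<nu> q - k" using near[OF q] by (simp add: k_def)
    show "\<nu> q - k \<le> N * \<epsilon>" using \<nu>_le_1[of q] by (simp add: k_def N\<epsilon>)
    show "1 - \<nu> q \<le> N * \<epsilon>" using near[OF q] \<epsilon> by (simp add: N\<epsilon>)
  qed (use R c k \<epsilon> in auto)
  also have "\<dots> \<le> curvature_const (c / 2) N * (D / R\<^sup>2) / (R / 2)\<^sup>2"
    using \<epsilon>_le curvature_const_nonneg[of "c / 2" N] c N
    by (intro divide_right_mono mult_left_mono) auto
  also have "\<dots> = 4 * curvature_const (c / 2) N * D / R ^ 4"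
    by (simp add: power_divide power4_eq_xxxx power2_eq_square mult.assoc)
  finally have Sp: "S p \<le> 4 * curvature_const (c / 2) N * D / R ^ 4" .
  define C where "C = 4 * curvature_const (c / 2) N * D"
  have C: "C \<ge> 0" using curvature_const_nonneg[of "c / 2" N] c N D by (simp add: C_def)
  have "c ^ 6 \<le> \<nu> p ^ 6" using \<nu>_ge[OF box] R c by (intro power_mono) auto
  then have "(norm (Hess u p))\<^sup>2 * c ^ 6 \<le> (norm (Hess u p))\<^sup>2 * \<nu> p ^ 6"
    by (intro mult_left_mono) auto
  also have "\<dots> \<le> C / R ^ 4" using norm_Hess_le[OF pO] Sp by (simp add: C_def)
  finally have "(norm (Hess u p))\<^sup>2 \<le> C / R ^ 4 / c ^ 6" using c by (subst pos_le_divide_eq) auto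
  also have "\<dots> = (sqrt (C / c ^ 6) / R\<^sup>2)\<^sup>2"
    using C c by (simp add: power_divide flip: power_mult)
  finally have "norm (Hess u p) \<le> sqrt (C / c ^ 6) / R\<^sup>2"
    by (rule power2_le_imp_le) (use C c in simp)
  also have "\<dots> \<le> hessian_const M / R\<^sup>2"
    unfolding hessian_const_def Let_def C_def D_def N_def c_def by (intro divide_right_mono) auto
  finally show ?thesis .
qed

end

section \<open>Distance to the boundary\<close>

lemma ball_subset_of_frontier_distance:
  fixes p :: "real ^ 2"
  assumes "p \<in> \<Omega>"
  shows "ball p (infdist p (frontier \<Omega>)) \<subseteq> \<Omega>"
proof (rule ccontr)
  assume "\<not> ?thesis"
  then obtain x where x: "x \<in> ball p (infdist p (frontier \<Omega>))" "x \<notin> \<Omega>" by blast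
  then have "p \<in> ball p (infdist p (frontier \<Omega>))" by (simp add: le_less_trans[OF zero_le_dist])
  with x assms have "ball p (infdist p (frontier \<Omega>)) \<inter> frontier \<Omega> \<noteq> {}"
    by (intro connected_Int_frontier connected_ball) blast+
  then obtain y where "y \<in> frontier \<Omega>" "dist p y < infdist p (frontier \<Omega>)" by auto
  then show False using infdist_le[of y "frontier \<Omega>" p] by simp
qed

text \<open>
The segment from $p$ to a nearest boundary point of the domain leaves the subset before it ends, and
the point of $\partial\Omega'$ on it has distance at least one from the end point.
\<close>

lemma frontier_distance_ge_1:
  fixes p :: "real ^ 2"
  assumes "open \<Omega>" "\<Omega>' \<subseteq> \<Omega>" "p \<in> \<Omega>'" "frontier \<Omega> \<noteq> {}"
    and dist: "set_set_dist (frontier \<Omega>') (frontier \<Omega>) \<ge> 1"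
  shows "infdist p (frontier \<Omega>) \<ge> 1"
proof -
  obtain q where q: "q \<in> frontier \<Omega>" "infdist p (frontier \<Omega>) = dist p q"
    using infdist_attains_inf[OF frontier_closed assms(4)] by metis
  have "q \<notin> \<Omega>'" using q(1) assms(1,2) by (auto simp: frontier_def interior_open)
  then have "closed_segment p q \<inter> frontier \<Omega>' \<noteq> {}"
    using connected_Int_frontier[OF connected_segment(1), of p q \<Omega>'] assms(3) by (metis DiffI Int_iff ends_in_segment empty_iff)
  then obtain r where r: "r \<in> closed_segment p q" "r \<in> frontier \<Omega>'" by auto
  have "1 \<le> set_set_dist (frontier \<Omega>') (frontier \<Omega>)" by (rule dist)
  also have "\<dots> \<le> point_set_dist r (frontier \<Omega>)" unfolding set_set_dist_def using r(2) by (rule INF_lower)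
  also have "\<dots> \<le> ereal (dist r q)" unfolding point_set_dist_def using q(1) by (rule INF_lower)
  finally have "1 \<le> dist r q" by simp
  also have "\<dots> \<le> dist p q" using dist_in_closed_segment[OF r(1)] by (simp add: dist_commute)
  finally show ?thesis using q(2) by simp
qed

lemma parabolic_box_subset_ball:
  assumes "d \<ge> 1"
  shows "parabolic_box p (sqrt d / 2) \<subseteq> ball p d"
proof
  fix x assume x: "x \<in> parabolic_box p (sqrt d / 2)"
  have s: "sqrt d \<le> d" using assms real_sqrt_le_mono[of d "d\<^sup>2"] by (simp add: power2_eq_square)
  have "\<bar>x $ 1 - p $ 1\<bar> \<le> d / 2" using x s by (simp add: parabolic_box_def)
  moreover have "(sqrt d / 2)\<^sup>2 = d / 4" using assms by (simp add: power_divide)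
  then have "x $ 2 - p $ 2 \<le> d / 4" "- (sqrt d / 2) \<le> x $ 2 - p $ 2" using x by (auto simp: parabolic_box_def)
  then have "\<bar>x $ 2 - p $ 2\<bar> \<le> d / 2" using s assms unfolding abs_le_iff by simp
  ultimately have "(x $ 1 - p $ 1)\<^sup>2 \<le> (d / 2)\<^sup>2" "(x $ 2 - p $ 2)\<^sup>2 \<le> (d / 2)\<^sup>2"
    using assms by (simp_all add: abs_le_square_iff[symmetric])
  moreover have "(d / 2)\<^sup>2 + (d / 2)\<^sup>2 < d\<^sup>2" using assms by (simp add: power2_eq_square)
  ultimately have "(dist x p)\<^sup>2 < d\<^sup>2"
    by (simp add: dist_norm norm_vec_def L2_set_def sum_2)
  then have "dist x p < d" by (rule power2_less_imp_less) (use assms in simp)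
  then show "x \<in> ball p d" by (simp add: dist_commute)
qed

lemma parabolic_box_subset_upward_sausage:
  assumes "d > 0"
  shows "parabolic_box p (d / 2) \<subseteq> upward_sausage d p"
proof
  fix x assume x: "x \<in> parabolic_box p (d / 2)"
  define t where "t = max 0 (x $ 2 - p $ 2)"
  have "(d / 2)\<^sup>2 < d\<^sup>2" using assms by (simp add: power2_eq_square)
  then have t: "t \<in> {0..<d\<^sup>2}" using x assms by (auto simp: t_def parabolic_box_def)
  let ?y = "x - t *\<^sub>R e3"
  have y: "?y $ 1 = x $ 1" "?y $ 2 = x $ 2 - t" by (simp_all add: axis_def)
  have "\<bar>?y $ 1 - p $ 1\<bar> \<le> d / 2" "\<bar>?y $ 2 - p $ 2\<bar> \<le> d / 2"
    unfolding y using x assms by (auto simp: t_def parabolic_box_def max_def)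
  then have "(?y $ 1 - p $ 1)\<^sup>2 \<le> (d / 2)\<^sup>2" "(?y $ 2 - p $ 2)\<^sup>2 \<le> (d / 2)\<^sup>2"
    using assms by (simp_all only: abs_le_square_iff[symmetric])
  moreover have "(d / 2)\<^sup>2 + (d / 2)\<^sup>2 < d\<^sup>2" using assms by (simp add: power2_eq_square)
  moreover have "(dist ?y p)\<^sup>2 = (?y $ 1 - p $ 1)\<^sup>2 + (?y $ 2 - p $ 2)\<^sup>2"
    unfolding dist_norm norm_vec_def L2_set_def sum_2 by simp
  ultimately have "(dist ?y p)\<^sup>2 < d\<^sup>2" by linarith
  then have "dist ?y p < d" by (rule power2_less_imp_less) (use assms in simp)
  then have "x = ?y + t *\<^sub>R e3" "?y \<in> ball p d" by (simp_all add: dist_commute)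
  then show "x \<in> upward_sausage d p" using t unfolding upward_sausage_def by blast
qed

lemma abs_le_sup_norm_on: "bounded (u ` \<Omega>) \<Longrightarrow> x \<in> \<Omega> \<Longrightarrow> \<bar>u x\<bar> \<le> sup_norm_on \<Omega> u"
  unfolding sup_norm_on_def
  by (rule cSUP_upper) (auto simp: bounded_iff bdd_above_def)

text \<open>
On the whole plane the estimate holds at every scale $R$.
\<close>

lemma entire_Hess_eq_0:
  assumes "translating_soliton_on UNIV u" "bounded (range u)"
  shows "Hess u p = 0"
proof (rule ccontr)
  assume "Hess u p \<noteq> 0"
  then have a: "norm (Hess u p) > 0" by simp
  interpret soliton UNIV u by unfold_locales (use assms in auto)
  let ?K = "hessian_const (sup_norm_on UNIV u)"
  define R where "R = max 1 (?K / norm (Hess u p) + 1)"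
  have "R \<ge> 1" by (simp add: R_def)
  then have "norm (Hess u p) \<le> ?K / R\<^sup>2"
    by (intro hessian_estimate) (use abs_le_sup_norm_on[OF assms(2)] in auto)
  then have "norm (Hess u p) * R\<^sup>2 \<le> ?K" by (simp add: R_def pos_le_divide_eq)
  moreover have "norm (Hess u p) * R \<le> norm (Hess u p) * R\<^sup>2"
    using self_le_power[of R 2] by (intro mult_left_mono) (auto simp: R_def)
  moreover have "norm (Hess u p) * (?K / norm (Hess u p) + 1) \<le> norm (Hess u p) * R"
    by (intro mult_left_mono) (auto simp: R_def)
  moreover have "norm (Hess u p) * (?K / norm (Hess u p) + 1) = ?K + norm (Hess u p)"
    using a by (simp add: distrib_left)
  ultimately show False using a by linarith
qed

lemma frontier_empty_imp_UNIV:
  fixes \<Omega> :: "(real ^ 2) set"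
  shows "frontier \<Omega> = {} \<Longrightarrow> \<Omega> \<noteq> {} \<Longrightarrow> \<Omega> = UNIV"
  by (simp add: frontier_eq_empty)

theorem proposition3p10:
  shows
    "(\<exists>K :: real \<Rightarrow> real. (\<forall>M\<ge>0. K M > 0) \<and>
        (\<forall>(\<Omega> :: (real ^ 2) set) (\<Omega>' :: (real ^ 2) set) (u :: real ^ 2 \<Rightarrow> real).
           open \<Omega> \<and> connected \<Omega> \<and> \<Omega> \<noteq> {} \<and>
           translating_soliton_on \<Omega> u \<and> bounded (u ` \<Omega>) \<and>
           \<Omega>' \<subset> \<Omega> \<and> set_set_dist (frontier \<Omega>') (frontier \<Omega>) \<ge> 1 \<longrightarrow>
           (\<forall>p\<in>\<Omega>'. ereal (norm (Hess u p))
                    \<le> ereal (K (sup_norm_on \<Omega> u)) / point_set_dist p (frontier \<Omega>))))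
     \<and>
     (\<exists>K :: real \<Rightarrow> real. (\<forall>M\<ge>0. K M > 0) \<and>
        (\<forall>(\<Omega> :: (real ^ 2) set) (\<Omega>' :: (real ^ 2) set) (u :: real ^ 2 \<Rightarrow> real).
           open \<Omega> \<and> connected \<Omega> \<and> \<Omega> \<noteq> {} \<and> upward_sausages_property \<Omega> \<and>
           translating_soliton_on \<Omega> u \<and> bounded (u ` \<Omega>) \<and>
           \<Omega>' \<subset> \<Omega> \<and> set_set_dist (frontier \<Omega>') (frontier \<Omega>) \<ge> 1 \<longrightarrow>
           (\<forall>p\<in>\<Omega>'. ereal (norm (Hess u p))
                    \<le> ereal (K (sup_norm_on \<Omega> u)) / (point_set_dist p (frontier \<Omega>))\<^sup>2)))"
proof -
  define K where "K M = 4 * hessian_const M" for M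
  have K: "\<forall>M\<ge>0. K M > 0" using hessian_const_pos by (simp add: K_def)
  have scale: "norm (Hess u p) \<le> hessian_const (sup_norm_on \<Omega> u) / R\<^sup>2"
    if "open \<Omega>" "translating_soliton_on \<Omega> u" "bounded (u ` \<Omega>)" "R \<ge> 1 / 2" "parabolic_box p R \<subseteq> \<Omega>"
    for \<Omega> u p R
  proof -
    interpret soliton \<Omega> u by unfold_locales (use that in auto)
    show ?thesis using that abs_le_sup_norm_on by (intro hessian_estimate) auto
  qed
  have general: "ereal (norm (Hess u p)) \<le> ereal (K (sup_norm_on \<Omega> u)) / point_set_dist p (frontier \<Omega>)"
    if "open \<Omega>" "\<Omega> \<noteq> {}" "translating_soliton_on \<Omega> u" "bounded (u ` \<Omega>)" "\<Omega>' \<subset> \<Omega>"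
      "set_set_dist (frontier \<Omega>') (frontier \<Omega>) \<ge> 1" "p \<in> \<Omega>'" for \<Omega> \<Omega>' u p
  proof (cases "frontier \<Omega> = {}")
    case True
    then have "\<Omega> = UNIV" using frontier_empty_imp_UNIV that(2) by blast
    then show ?thesis using entire_Hess_eq_0 that by simp
  next
    case False
    let ?d = "infdist p (frontier \<Omega>)"
    have d: "?d \<ge> 1" using frontier_distance_ge_1 False that by blast
    have "parabolic_box p (sqrt ?d / 2) \<subseteq> \<Omega>"
      using parabolic_box_subset_ball[OF d] ball_subset_of_frontier_distance[of p \<Omega>] that by blast
    then have "norm (Hess u p) \<le> hessian_const (sup_norm_on \<Omega> u) / (sqrt ?d / 2)\<^sup>2"
      using that d by (intro scale) auto
    also have "\<dots> = K (sup_norm_on \<Omega> u) / ?d" using d by (simp add: K_def power_divide)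
    finally show ?thesis using d by (simp add: point_set_dist_nonempty[OF False])
  qed
  have sausage: "ereal (norm (Hess u p)) \<le> ereal (K (sup_norm_on \<Omega> u)) / (point_set_dist p (frontier \<Omega>))\<^sup>2"
    if "open \<Omega>" "\<Omega> \<noteq> {}" "upward_sausages_property \<Omega>" "translating_soliton_on \<Omega> u" "bounded (u ` \<Omega>)" "\<Omega>' \<subset> \<Omega>"
      "set_set_dist (frontier \<Omega>') (frontier \<Omega>) \<ge> 1" "p \<in> \<Omega>'" for \<Omega> \<Omega>' u p
  proof (cases "frontier \<Omega> = {}")
    case True
    then have "\<Omega> = UNIV" using frontier_empty_imp_UNIV that(2) by blast
    then show ?thesis using entire_Hess_eq_0 that by simp
  next
    case False
    let ?d = "infdist p (frontier \<Omega>)"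
    have d: "?d \<ge> 1" using frontier_distance_ge_1 False that by blast
    have "upward_sausage ?d p \<subseteq> \<Omega>" using that False by (auto simp: upward_sausages_property_def)
    then have "parabolic_box p (?d / 2) \<subseteq> \<Omega>"
      using parabolic_box_subset_upward_sausage[of ?d p] d by auto
    then have "norm (Hess u p) \<le> hessian_const (sup_norm_on \<Omega> u) / (?d / 2)\<^sup>2"
      using that d by (intro scale) auto
    also have "\<dots> = K (sup_norm_on \<Omega> u) / ?d\<^sup>2" by (simp add: K_def power_divide)
    finally show ?thesis using d by (simp add: point_set_dist_nonempty[OF False])
  qed
  show ?thesis
    using K general sausage by (intro conjI exI[of _ K]) blast+
qed

end
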